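(* Let $d\ge 3$ be an integer, let $T_d$ be the infinite $d$-regular tree with root $o$, and let $p_n(e,e)$ be the $n$-step return probability to the identity state $e=(o,\mathbf 0)$ of the switch--walk--switch lamplighter walk over $T_d$ with lamp group $\mathbb Z_2$. Then, as $n\to\infty$, \[ p_{2n}(e,e)=\rho_d^{2n}\exp\left[-\left(\pi^2(\log(d-1))^2+o(1)\right)\frac{n}{\log^2 n}\right], \] where \[ \rho_d=\frac{2\sqrt{d-1}}{d} \] is the spectral radius of simple random walk on $T_d$.
   Context: Let $V$ be the vertex set of $T_d$ and fix a root $o\in V$. The lamplighter state space is $V\times \mathbb Z_2^{(V)}$, where $\mathbb Z_2^{(V)}$ is the set of finitely supported functions $\eta:V\to\mathbb Z_2$ (lamp configurations); in a state $(x,\eta)$, $x$ is the position of the lamplighter. The identity state is $e=(o,\mathbf 0)$, with $\mathbf 0$ the all-zero configuration. One step of the switch--walk--switch walk from $(x,\eta)$ is: first resample the lamp at $x$ from the uniform measure on $\mathbb Z_2$, then move from $x$ to a uniformly chosen neighbor $y$ of $x$ in $T_d$, then resample the lamp at $y$ from the uniform measure on $\mathbb Z_2$, independently of all previous choices. $p_n(e,e)$ is the probability that this Markov chain started at $e$ is at $e$ after $n$ steps. $\log$ is the natural logarithm and $\log^2 n=(\log n)^2$. *)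

theory Defs
  imports
    "HOL-Probability.Probability"
    "HOL-Library.Z2"
    "HOL-Library.Poly_Mapping"
begin

text \<open>
  A graph is given by its adjacency relation; its vertices are all elements of the type.
  A cycle is listed by its vertices without repetition of the starting point. Requiring
  length at least 3 excludes the back-and-forth walks that exist in any symmetric relation.
\<close>

definition is_cycle :: "('v \<Rightarrow> 'v \<Rightarrow> bool) \<Rightarrow> 'v list \<Rightarrow> bool" where
  "is_cycle E c \<longleftrightarrow> length c \<ge> 3 \<and> distinct c \<and>
     (\<forall>i < length c. E (c ! i) (c ! (Suc i mod length c)))"

text \<open>
  For \<open>d \<ge> 2\<close> such a tree is automatically infinite, and it is unique up to isomorphism.
\<close>

definition regular_tree :: "nat \<Rightarrow> ('v \<Rightarrow> 'v \<Rightarrow> bool) \<Rightarrow> bool" where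
  "regular_tree d E \<longleftrightarrow> symp E \<and> irreflp E \<and> (\<forall>x y. E\<^sup>*\<^sup>* x y) \<and> (\<nexists>c. is_cycle E c) \<and>
     (\<forall>x. finite {y. E x y} \<and> card {y. E x y} = d)"

primrec n_steps :: "('s \<Rightarrow> 's pmf) \<Rightarrow> nat \<Rightarrow> 's \<Rightarrow> 's pmf" where
  "n_steps K 0 s = return_pmf s"
| "n_steps K (Suc n) s = bind_pmf (K s) (n_steps K n)"

definition return_prob :: "('s \<Rightarrow> 's pmf) \<Rightarrow> nat \<Rightarrow> 's \<Rightarrow> real" where
  "return_prob K n s = pmf (n_steps K n s) s"

definition walk_step :: "('v \<Rightarrow> 'v \<Rightarrow> bool) \<Rightarrow> 'v \<Rightarrow> 'v pmf" where
  "walk_step E x = pmf_of_set {y. E x y}"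

definition spectral_radius :: "('s \<Rightarrow> 's pmf) \<Rightarrow> 's \<Rightarrow> ereal" where
  "spectral_radius K s = limsup (\<lambda>n. ereal (root n (return_prob K n s)))"

text \<open>
  A lamp configuration is an element of the type \<open>'v \<Rightarrow>\<^sub>0 bit\<close> of finitely supported functions
  to the two-element field; the all-zero configuration is \<open>0\<close>.
\<close>

definition resample_lamp :: "'v \<Rightarrow> ('v \<Rightarrow>\<^sub>0 bit) \<Rightarrow> ('v \<Rightarrow>\<^sub>0 bit) pmf" where
  "resample_lamp x \<eta> = map_pmf (\<lambda>a. Poly_Mapping.update x a \<eta>) (pmf_of_set {0, 1})"

definition sws_step :: "('v \<Rightarrow> 'v \<Rightarrow> bool) \<Rightarrow> 'v \<times> ('v \<Rightarrow>\<^sub>0 bit) \<Rightarrow> ('v \<times> ('v \<Rightarrow>\<^sub>0 bit)) pmf" where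
  "sws_step E = (\<lambda>(x, \<eta>). do {
     \<eta>' \<leftarrow> resample_lamp x \<eta>;
     y \<leftarrow> walk_step E x;
     \<eta>'' \<leftarrow> resample_lamp y \<eta>';
     return_pmf (y, \<eta>'')
   })"

definition rho :: "nat \<Rightarrow> real" where
  "rho d = 2 * sqrt (real d - 1) / real d"

end

theory Submission
  imports Defs "HOL-Real_Asymp.Real_Asymp"
begin

text \<open>
  Write \<open>b = d - 1\<close> and \<open>L = ln b\<close>. Resampling a lamp annihilates every character of the lamp group
  that is non-trivial at that lamp. Expanding in characters therefore turns the return probability of
  the lamplighter into the mean, over a uniformly random set \<open>S\<close> of vertices, of the return
  probability of the simple random walk killed outside \<open>S\<close> (\<open>return_prob_sws\<close>): site percolation
  with parameter \<open>1/2\<close>. Both bounds are statements about these killed walks.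

  \<^emph>\<open>Lower bound.\<close> The ball of radius \<open>r\<close> is contained in \<open>S\<close> with probability \<open>2\<close> to the minus its size,
  and the walk killed outside it has the positive radial subsolution
  \<open>b powr (-j/2) * sin ((j+1) \<theta>)\<close> (\<open>j\<close> the depth, \<open>\<theta> = pi/(r+2)\<close>) at level \<open>rho d * cos \<theta>\<close>
  (\<open>killed_return_root_ball_ge\<close>). If \<open>b^r\<close> is about \<open>n / (ln n)^4\<close>, the cost of an open ball is negligible
  against \<open>n / (ln n)^2\<close>, and \<open>cos \<theta> ^ (2n)\<close> is \<open>exp (- (pi^2 L^2 + o(1)) n / (ln n)^2)\<close>.

  \<^emph>\<open>Upper bound.\<close> A positive supersolution of the killed walk at level \<open>rho d * cos \<theta>\<close> can be built from
  the root downwards: if \<open>u x / sqrt b\<close> is the quotient of its values at \<open>x\<close> and at the parent of \<open>x\<close>,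
  what is required is the recursion \<open>u x = 1 / (2 cos \<theta> - avg)\<close>, where \<open>avg\<close> is the average of \<open>u\<close> over the
  \<open>b\<close> children and \<open>u = 0\<close> at closed vertices. The substitution \<open>u = sin (\<gamma> - \<theta>) / sin \<gamma>\<close> turns
  the map \<open>t \<mapsto> 1 / (2 cos \<theta> - t)\<close> into \<open>\<gamma> \<mapsto> \<gamma> + \<theta>\<close>, so \<open>u\<close> can only blow up (\<open>\<gamma>\<close> reaches \<open>pi\<close>) after
  about \<open>pi/\<theta>\<close> generations that are almost completely open. To quantify this, weigh \<open>u\<close> by
  \<open>W u = b powr (\<gamma>/\<theta>)\<close>, which one step of the recursion multiplies by \<open>b\<close>. On the relevant range \<open>W\<close> is a convex
  function of \<open>u\<close>, and Jensen's inequality gives \<open>W (u x) \<le> (\<Sum> W (u y))\<close>, the sum being over the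
  children \<open>y\<close> of \<open>x\<close> (\<open>weight_capped_step_le_sum\<close>). Since the
  subtrees of the children are independent, the mean of \<open>exp (K * W (u x))\<close> on the event that \<open>x\<close> is open
  stays bounded by \<open>1\<close> through all generations (\<open>mean_open_weight_le_1\<close>) for a small constant \<open>K\<close>. So
  \<open>u\<close> comes close to blowing up at a given vertex with probability at most \<open>exp (- K' b powr (pi/\<theta>))\<close>,
  doubly exponentially small in \<open>1/\<theta>\<close>. With \<open>b powr (pi/\<theta>) = n * ln n\<close> this beats the number of vertices
  within distance \<open>2n\<close> of the root, and \<open>cos \<theta> ^ (2n)\<close> again has exponent
  \<open>- (pi^2 L^2 + o(1)) n / (ln n)^2\<close>.
\<close>

section \<open>Rooting a regular tree\<close>

text \<open>
  Walks without immediate reversal. Unlike simple paths they can be glued along a vertex under a purely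
  local condition, which makes the uniqueness proof below short.
\<close>

fun nonbacktracking :: "('v \<Rightarrow> 'v \<Rightarrow> bool) \<Rightarrow> 'v list \<Rightarrow> bool" where
  "nonbacktracking E [] \<longleftrightarrow> False"
| "nonbacktracking E [x] \<longleftrightarrow> True"
| "nonbacktracking E [x, y] \<longleftrightarrow> E x y"
| "nonbacktracking E (x # y # z # p) \<longleftrightarrow> E x y \<and> x \<noteq> z \<and> nonbacktracking E (y # z # p)"

lemma nonbacktracking_Cons2: "nonbacktracking E (x # y # p) \<Longrightarrow> E x y \<and> nonbacktracking E (y # p)"
  by (cases p) auto

lemma nonbacktracking_edge: "nonbacktracking E p \<Longrightarrow> Suc i < length p \<Longrightarrow> E (p ! i) (p ! Suc i)"
proof (induction p arbitrary: i)
  case (Cons x p)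
  then show ?case
    by (cases p; cases i) (auto dest: nonbacktracking_Cons2)
qed simp

lemma nonbacktracking_turn: "nonbacktracking E p \<Longrightarrow> Suc (Suc i) < length p \<Longrightarrow> p ! i \<noteq> p ! Suc (Suc i)"
proof (induction E p arbitrary: i rule: nonbacktracking.induct)
  case (4 E x y z p)
  then show ?case by (cases i) auto
qed auto

text \<open>
  Two visits to the same vertex at minimal time difference enclose a closed walk without further
  repetition; its length is not \<open>1\<close> (no loops) nor \<open>2\<close> (no reversal), so it is a cycle.
\<close>

lemma nonbacktracking_distinct:
  assumes "irreflp E" and acyc: "\<nexists>c. is_cycle E c" and p: "nonbacktracking E p"
  shows "distinct p"
proof (rule ccontr)
  assume "\<not> distinct p"
  then obtain i j where "i < j" "j < length p" "p ! i = p ! j"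
    by (metis distinct_conv_nth linorder_neqE_nat)
  then have ex: "\<exists>l. \<exists>i. 0 < l \<and> i + l < length p \<and> p ! i = p ! (i + l)"
    by (intro exI[of _ "j - i"] exI[of _ i]) auto
  define l where "l = (LEAST l. \<exists>i. 0 < l \<and> i + l < length p \<and> p ! i = p ! (i + l))"
  obtain i where l: "0 < l" "i + l < length p" "p ! i = p ! (i + l)"
    using LeastI_ex[OF ex] unfolding l_def by auto
  have least: "l \<le> l'" if "0 < l'" "k + l' < length p" "p ! k = p ! (k + l')" for k l'
    unfolding l_def by (rule Least_le) (use that in blast)
  have "l \<noteq> 1"
    using nonbacktracking_edge[OF p, of i] l assms(1) by (auto simp: irreflp_def)
  moreover have "l \<noteq> 2"
    using nonbacktracking_turn[OF p, of i] l by auto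
  ultimately have l3: "l \<ge> 3" using l(1) by linarith
  define c where "c = take l (drop i p)"
  have len: "length c = l" using l by (simp add: c_def)
  have nth: "c ! k = p ! (i + k)" if "k < l" for k
    using that l by (simp add: c_def)
  have "distinct c"
    unfolding distinct_conv_nth len
  proof (intro allI impI)
    have *: "c ! k \<noteq> c ! m" if "k < m" "m < l" for k m
      using that least[of "m - k" "i + k"] l nth by force
    fix k m assume "k < l" "m < l" "k \<noteq> m"
    then show "c ! k \<noteq> c ! m" using *[of k m] *[of m k] by (metis linorder_neqE_nat)
  qed
  moreover have "E (c ! k) (c ! (Suc k mod l))" if "k < l" for k
  proof (cases "Suc k = l")
    case True
    have "E (p ! (i + k)) (p ! Suc (i + k))"
      by (rule nonbacktracking_edge[OF p]) (use True l in auto)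
    moreover have "p ! Suc (i + k) = p ! i" using True l by auto
    ultimately show ?thesis using True nth[of k] nth[of 0] l by auto
  next
    case False
    then show ?thesis using that nth[of k] nth[of "Suc k"] nonbacktracking_edge[OF p, of "i + k"] l
      by auto
  qed
  ultimately have "is_cycle E c" using l3 len by (auto simp: is_cycle_def)
  then show False using acyc by blast
qed

text \<open>
  A walk read backwards can be continued by another walk that leaves by a different edge.
\<close>

lemma nonbacktracking_glue:
  assumes "symp E"
  shows "nonbacktracking E (x # y # p) \<Longrightarrow> nonbacktracking E (y # x # q) \<Longrightarrow> nonbacktracking E (rev p @ y # x # q)"
proof (induction p arbitrary: x y q)
  case (Cons w p)
  then have "E w y" using nonbacktracking_Cons2[of E y w p] assms by (auto dest: sympD)
  then have "nonbacktracking E (w # y # x # q)" using Cons.prems by auto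
  then show ?case using Cons.IH[of y w "x # q"] Cons.prems by auto
qed simp

text \<open>
  If two such walks to the same end separated, running back along one and out along the other would give
  a walk without reversal that visits the common end twice.
\<close>

lemma nonbacktracking_unique:
  assumes "symp E" "irreflp E" "\<nexists>c. is_cycle E c"
  shows "nonbacktracking E (x # p) \<Longrightarrow> nonbacktracking E (x # q) \<Longrightarrow> last (x # p) = last (x # q) \<Longrightarrow> p = q"
proof (induction p arbitrary: x q)
  case Nil
  have "distinct (x # q)" using nonbacktracking_distinct[OF assms(2,3) Nil(2)] .
  then show ?case using Nil(3) by (cases q rule: rev_cases) auto
next
  case (Cons y p)
  have dist: "distinct (x # y # p)" using nonbacktracking_distinct[OF assms(2,3) Cons.prems(1)] .
  show ?case
  proof (cases q)
    case Nil
    then show ?thesis using Cons.prems(3) dist last_in_set[of "y # p"] by auto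
  next
    case q: (Cons z s)
    show ?thesis
    proof (cases "y = z")
      case True
      then show ?thesis
        using Cons.IH[of y s] Cons.prems q nonbacktracking_Cons2[of E x y p] nonbacktracking_Cons2[of E x y s]
        by simp
    next
      case False
      have "E y x" using nonbacktracking_Cons2[OF Cons.prems(1)] assms(1) by (auto dest: sympD)
      then have "nonbacktracking E (y # x # z # s)" using False Cons.prems(2) q by auto
      from nonbacktracking_glue[OF assms(1) Cons.prems(1) this]
      have d: "distinct (rev p @ y # x # z # s)" by (rule nonbacktracking_distinct[OF assms(2,3)])
      have "last (x # y # p) \<in> set (y # p)" "last (x # q) \<in> set (z # s)"
        using q last_in_set[of "y # p"] last_in_set[of "z # s"] by auto
      then show ?thesis using d Cons.prems(3) by auto
    qed
  qed
qed

lemma nonbacktracking_exists: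
  assumes "symp E" and "E\<^sup>*\<^sup>* r x"
  shows "\<exists>p. nonbacktracking E (x # p) \<and> last (x # p) = r"
  using assms(2)
proof (induction rule: rtranclp_induct)
  case base
  show ?case by (rule exI[of _ "[]"]) simp
next
  case (step y z)
  then obtain p where p: "nonbacktracking E (y # p)" "last (y # p) = r" by blast
  have "E z y" using step assms(1) by (auto dest: sympD)
  show ?case
  proof (cases "\<exists>s. p = z # s")
    case True
    then obtain s where s: "p = z # s" by blast
    then show ?thesis using p nonbacktracking_Cons2[of E y z s] by (intro exI[of _ s]) simp
  next
    case False
    then have "nonbacktracking E (z # y # p)" using \<open>E z y\<close> p by (cases p) auto
    then show ?thesis using p by (intro exI[of _ "y # p"]) auto
  qed
qed

text \<open>
  The form in which the tree is used from now on: each vertex other than the root has a parent, which is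
  one step closer to the root, and the edges are exactly the pairs of parent and child.
\<close>

locale rooted_tree =
  fixes E :: "'v \<Rightarrow> 'v \<Rightarrow> bool" and rt :: 'v and par :: "'v \<Rightarrow> 'v" and dep :: "'v \<Rightarrow> nat"
    and b :: nat
  assumes E_iff: "E x y \<longleftrightarrow> (y \<noteq> rt \<and> par y = x) \<or> (x \<noteq> rt \<and> par x = y)"
    and dep_rt: "dep rt = 0"
    and dep_par: "x \<noteq> rt \<Longrightarrow> dep x = Suc (dep (par x))"
    and finite_nbrs: "finite {y. E x y}"
    and card_nbrs: "card {y. E x y} = Suc b"
    and b_ge: "b \<ge> 2"

text \<open>
  The parent of \<open>x\<close> is the second vertex on the unique non-reversing walk from \<open>x\<close> to the root, and the
  depth is the length of that walk.
\<close>

theorem regular_tree_rooted: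
  assumes "d \<ge> 3" "regular_tree d E"
  shows "\<exists>par dep. rooted_tree E r par dep (d - 1)"
proof -
  have tr: "symp E" "irreflp E" "\<nexists>c. is_cycle E c" and conn: "\<And>x y. E\<^sup>*\<^sup>* x y"
    and fin: "\<And>x. finite {y. E x y}" and card: "\<And>x. card {y. E x y} = d"
    using assms(2) unfolding regular_tree_def by auto
  have "\<forall>x. \<exists>p. nonbacktracking E (x # p) \<and> last (x # p) = r"
    using nonbacktracking_exists[OF tr(1) conn] by blast
  from choice[OF this] obtain P where P: "\<And>x. nonbacktracking E (x # P x) \<and> last (x # P x) = r"
    by blast
  have uniq: "P x = p" if "nonbacktracking E (x # p)" "last (x # p) = r" for x p
    using nonbacktracking_unique[OF tr, of x "P x" p] P[of x] that by simp
  have P_rt: "P r = []" by (rule uniq) auto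
  have P_ne: "P x \<noteq> []" if "x \<noteq> r" for x using P[of x] that by (cases "P x") auto
  define par where "par = (\<lambda>x. hd (P x))"
  define dep where "dep = (\<lambda>x. length (P x))"
  have P_par: "P x = par x # P (par x) \<and> E x (par x)" if x: "x \<noteq> r" for x
  proof -
    obtain y s where ys: "P x = y # s" using P_ne[OF x] by (cases "P x") auto
    then have w: "nonbacktracking E (x # y # s)" "last (x # y # s) = r" using P[of x] by auto
    have "P y = s" by (rule uniq) (use w nonbacktracking_Cons2[OF w(1)] in auto)
    then show ?thesis using ys nonbacktracking_Cons2[OF w(1)] by (auto simp: par_def)
  qed
  have E_par: "(y \<noteq> r \<and> par y = x) \<or> (x \<noteq> r \<and> par x = y)" if "E x y" for x y
  proof (cases "\<exists>s. P x = y # s")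
    case True
    then show ?thesis using P_rt by (auto simp: par_def)
  next
    case False
    have "E y x" using that tr(1) by (auto dest: sympD)
    then have "nonbacktracking E (y # x # P x)" using False P[of x] by (cases "P x") auto
    moreover have "last (y # x # P x) = r" using P[of x] by auto
    ultimately have "P y = x # P x" by (rule uniq)
    then show ?thesis using P_rt by (auto simp: par_def)
  qed
  have "rooted_tree E r par dep (d - 1)"
  proof
    show "E x y \<longleftrightarrow> (y \<noteq> r \<and> par y = x) \<or> (x \<noteq> r \<and> par x = y)" for x y
      using E_par[of x y] P_par[of x] P_par[of y] tr(1) by (auto dest: sympD)
    show "dep r = 0" by (simp add: dep_def P_rt)
    show "dep x = Suc (dep (par x))" if "x \<noteq> r" for x
    proof -
      have "length (P x) = length (par x # P (par x))" using P_par[OF that] by metis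
      then show ?thesis by (simp add: dep_def)
    qed
  qed (use fin card assms(1) in auto)
  then show ?thesis by blast
qed

context rooted_tree begin

definition ch :: "'v \<Rightarrow> 'v set" where
  "ch x = {y. y \<noteq> rt \<and> par y = x}"

definition root_ball :: "nat \<Rightarrow> 'v set" where
  "root_ball n = {x. dep x \<le> n}"

lemma dep_0_iff: "dep x = 0 \<longleftrightarrow> x = rt"
  using dep_rt dep_par[of x] by (cases "x = rt") auto

lemma dep_ch: "y \<in> ch x \<Longrightarrow> dep y = Suc (dep x)"
  using dep_par[of y] by (auto simp: ch_def)

lemma nbrs_rt: "{y. E rt y} = ch rt"
  by (auto simp: E_iff ch_def)

lemma nbrs_insert: "x \<noteq> rt \<Longrightarrow> {y. E x y} = insert (par x) (ch x)"
  by (auto simp: E_iff ch_def)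

lemma par_notin_ch: "x \<noteq> rt \<Longrightarrow> par x \<notin> ch x"
  using dep_ch[of "par x" x] dep_par[of x] by auto

lemma finite_ch: "finite (ch x)"
  by (rule finite_subset[OF _ finite_nbrs[of x]]) (auto simp: E_iff ch_def)

lemma card_ch: "card (ch x) = (if x = rt then Suc b else b)"
proof (cases "x = rt")
  case False
  have "card (insert (par x) (ch x)) = Suc b" using card_nbrs[of x] nbrs_insert[OF False] by simp
  then show ?thesis using False par_notin_ch[OF False] finite_ch by simp
qed (use card_nbrs[of rt] nbrs_rt in simp)

lemma E_sym: "E x y \<longleftrightarrow> E y x"
  by (auto simp: E_iff)

lemma dep_nbr: "E x y \<Longrightarrow> dep y \<le> Suc (dep x)"
  using dep_par[of x] dep_par[of y] by (auto simp: E_iff)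

lemma card_sphere: "finite {x. dep x = n} \<and> card {x. dep x = n} \<le> 2 * b ^ n"
proof (induction n)
  case 0
  have "{x. dep x = 0} = {rt}" by (auto simp: dep_0_iff)
  then show ?case by simp
next
  case (Suc n)
  have eq: "{x. dep x = Suc n} = (\<Union>x\<in>{x. dep x = n}. ch x)"
  proof (intro equalityI subsetI)
    fix y assume y: "y \<in> {x. dep x = Suc n}"
    then have "y \<noteq> rt" using dep_rt by auto
    then have "dep (par y) = n" using dep_par[of y] y by simp
    then show "y \<in> (\<Union>x\<in>{x. dep x = n}. ch x)" using \<open>y \<noteq> rt\<close> by (auto simp: ch_def)
  qed (auto simp: dep_ch)
  have fin: "finite {x. dep x = Suc n}" unfolding eq using Suc finite_ch by auto
  show ?case
  proof (cases n)
    case 0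
    then have "{x. dep x = n} = {rt}" by (auto simp: dep_0_iff)
    then have "card {x. dep x = Suc n} = Suc b" using eq card_ch[of rt] by simp
    then show ?thesis using fin 0 b_ge by simp
  next
    case (Suc m)
    have "card {x. dep x = Suc n} \<le> (\<Sum>x\<in>{x. dep x = n}. card (ch x))"
      unfolding eq by (rule card_UN_le) (use Suc.IH in auto)
    also have "\<dots> = card {x. dep x = n} * b"
      using Suc dep_rt by (subst sum.cong[OF refl, where h="\<lambda>_. b"]) (auto simp: card_ch)
    also have "\<dots> \<le> (2 * b ^ n) * b" using Suc.IH by simp
    finally show ?thesis using fin by (simp add: mult.commute)
  qed
qed

lemma card_root_ball: "finite (root_ball n) \<and> card (root_ball n) \<le> 2 * b ^ Suc n"
proof (induction n)
  case 0
  have "root_ball 0 = {rt}" by (auto simp: root_ball_def dep_0_iff)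
  then show ?case using b_ge by simp
next
  case (Suc n)
  have eq: "root_ball (Suc n) = root_ball n \<union> {x. dep x = Suc n}" by (auto simp: root_ball_def)
  have "card (root_ball (Suc n)) \<le> 2 * b ^ Suc n + 2 * b ^ Suc n"
    unfolding eq using card_Un_le[of "root_ball n" "{x. dep x = Suc n}"] Suc card_sphere[of "Suc n"]
    by linarith
  also have "\<dots> \<le> 2 * b ^ Suc (Suc n)"
    using mult_right_mono[OF b_ge, of "2 * b ^ Suc n"] by (simp add: mult_ac)
  finally show ?case using eq Suc card_sphere[of "Suc n"] by auto
qed

end

section \<open>Means over random subsets\<close>

text \<open>
  Expectation over a uniformly random subset of \<open>B\<close>, that is, over independent fair coins.
\<close>

definition subset_mean :: "'v set \<Rightarrow> ('v set \<Rightarrow> real) \<Rightarrow> real" where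
  "subset_mean B f = (\<Sum>S\<in>Pow B. f S) / 2 ^ card B"

definition depends_on :: "('v set \<Rightarrow> 'a) \<Rightarrow> 'v set \<Rightarrow> bool" where
  "depends_on f D \<longleftrightarrow> (\<forall>S. f S = f (S \<inter> D))"

lemma subset_mean_empty: "subset_mean {} f = f {}"
  by (simp add: subset_mean_def)

lemma subset_mean_insert:
  assumes "finite B" "a \<notin> B"
  shows "subset_mean (insert a B) f = (subset_mean B f + subset_mean B (\<lambda>S. f (insert a S))) / 2"
proof -
  have "(\<Sum>S\<in>Pow (insert a B). f S) = (\<Sum>S\<in>Pow B. f S) + (\<Sum>S\<in>insert a ` Pow B. f S)"
    unfolding Pow_insert by (rule sum.union_disjoint) (use assms in auto)
  also have "(\<Sum>S\<in>insert a ` Pow B. f S) = (\<Sum>S\<in>Pow B. f (insert a S))"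
    by (subst sum.reindex) (use assms in \<open>auto simp: inj_on_def\<close>)
  finally show ?thesis using assms by (simp add: subset_mean_def add_divide_distrib)
qed

lemma subset_mean_mono: "(\<And>S. S \<subseteq> B \<Longrightarrow> f S \<le> g S) \<Longrightarrow> subset_mean B f \<le> subset_mean B g"
  unfolding subset_mean_def by (intro divide_right_mono sum_mono) auto

lemma subset_mean_cong: "(\<And>S. S \<subseteq> B \<Longrightarrow> f S = g S) \<Longrightarrow> subset_mean B f = subset_mean B g"
  unfolding subset_mean_def by (auto intro: sum.cong)

lemma subset_mean_add: "subset_mean B (\<lambda>S. f S + g S) = subset_mean B f + subset_mean B g"
  by (simp add: subset_mean_def sum.distrib add_divide_distrib)

lemma subset_mean_diff: "subset_mean B (\<lambda>S. f S - g S) = subset_mean B f - subset_mean B g"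
  by (simp add: subset_mean_def sum_subtractf diff_divide_distrib)

lemma subset_mean_cmult: "subset_mean B (\<lambda>S. c * f S) = c * subset_mean B f"
  by (simp add: subset_mean_def sum_distrib_left)

lemma subset_mean_sum: "subset_mean B (\<lambda>S. \<Sum>i\<in>A. f i S) = (\<Sum>i\<in>A. subset_mean B (f i))"
  unfolding subset_mean_def by (subst sum.swap) (simp add: sum_divide_distrib)

lemma subset_mean_const: "finite B \<Longrightarrow> subset_mean B (\<lambda>S. c) = c"
  by (simp add: subset_mean_def card_Pow)

lemma depends_on_mono: "depends_on f D \<Longrightarrow> D \<subseteq> D' \<Longrightarrow> depends_on f D'"
  unfolding depends_on_def by (metis Int_absorb1 Int_assoc)

lemma depends_on_comp2:
  assumes "depends_on f D" "depends_on g D"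
  shows "depends_on (\<lambda>S. h (f S) (g S)) D"
  using assms unfolding depends_on_def by metis

lemma depends_on_insert:
  assumes "depends_on f D"
  shows "depends_on (\<lambda>S. f (insert a S)) D"
  unfolding depends_on_def
proof
  fix S
  have "insert a S \<inter> D = insert a (S \<inter> D) \<inter> D" by auto
  then show "f (insert a S) = f (insert a (S \<inter> D))" using assms unfolding depends_on_def by metis
qed

lemma depends_on_insert_notin: "depends_on f D \<Longrightarrow> a \<notin> D \<Longrightarrow> f (insert a S) = f S"
  unfolding depends_on_def by (metis Int_insert_left_if0)

text \<open>
  Independence of functions of disjoint sets of coins, by revealing one coin at a time: each coin
  influences at most one of the two factors.
\<close>

lemma subset_mean_indep:
  assumes "finite B" "D \<inter> D' = {}" "depends_on f D" "depends_on g D'"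
  shows "subset_mean B (\<lambda>S. f S * g S) = subset_mean B f * subset_mean B g"
  using assms
proof (induction B arbitrary: f g rule: finite_induct)
  case empty
  show ?case by (simp add: subset_mean_empty)
next
  case (insert a B)
  note ins = subset_mean_insert[OF insert.hyps]
  note df = depends_on_insert[OF insert.prems(2), of a] and dg = depends_on_insert[OF insert.prems(3), of a]
  have "a \<notin> D \<or> a \<notin> D'" using insert.prems by auto
  then show ?case
  proof
    assume "a \<notin> D"
    then have "f (insert a S) = f S" for S using depends_on_insert_notin insert.prems by metis
    then show ?thesis
      using insert.IH[OF insert.prems(1,2) dg] insert.IH[OF insert.prems] unfolding ins
      by (simp add: algebra_simps add_divide_distrib)
  next
    assume "a \<notin> D'"
    then have "g (insert a S) = g S" for S using depends_on_insert_notin insert.prems by metis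
    then show ?thesis
      using insert.IH[OF insert.prems(1) df insert.prems(3)] insert.IH[OF insert.prems] unfolding ins
      by (simp add: algebra_simps add_divide_distrib)
  qed
qed

lemma subset_mean_prod_indep:
  assumes "finite B" "finite I" "disjoint_family_on D I" "\<And>i. i \<in> I \<Longrightarrow> depends_on (f i) (D i)"
  shows "subset_mean B (\<lambda>S. \<Prod>i\<in>I. f i S) = (\<Prod>i\<in>I. subset_mean B (f i))
    \<and> depends_on (\<lambda>S. \<Prod>i\<in>I. f i S) (\<Union>i\<in>I. D i)"
  using assms(2-)
proof (induction I rule: finite_induct)
  case empty
  show ?case using assms(1) by (simp add: subset_mean_const depends_on_def)
next
  case (insert i I)
  have IH: "subset_mean B (\<lambda>S. \<Prod>i\<in>I. f i S) = (\<Prod>i\<in>I. subset_mean B (f i))"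
    "depends_on (\<lambda>S. \<Prod>i\<in>I. f i S) (\<Union>i\<in>I. D i)"
    using insert.IH insert.prems by (auto simp: disjoint_family_on_def)
  have dj: "D i \<inter> (\<Union>i\<in>I. D i) = {}"
    using insert.prems insert.hyps unfolding disjoint_family_on_def by auto
  have di: "depends_on (f i) (D i)" using insert.prems by simp
  have "depends_on (\<lambda>S. f i S * (\<Prod>i\<in>I. f i S)) (\<Union>i\<in>insert i I. D i)"
    by (intro depends_on_comp2[where h="(*)"] depends_on_mono[OF di] depends_on_mono[OF IH(2)]) auto
  then show ?case
    using insert.hyps subset_mean_indep[OF assms(1) dj di IH(2)] IH(1) by simp
qed

lemma subset_mean_mem:
  assumes "finite B" "x \<in> B"
  shows "subset_mean B (\<lambda>S. of_bool (x \<in> S)) = 1 / 2"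
proof -
  define C where "C = B - {x}"
  have C: "finite C" "x \<notin> C" "B = insert x C" using assms by (auto simp: C_def)
  have "subset_mean C (\<lambda>S. of_bool (x \<in> S)) = subset_mean C (\<lambda>S. 0)"
    by (rule subset_mean_cong) (use C in auto)
  then show ?thesis using C by (simp add: subset_mean_insert subset_mean_const)
qed

lemma subset_mean_superset:
  assumes "finite B" "A \<subseteq> B"
  shows "subset_mean B (\<lambda>S. of_bool (A \<subseteq> S)) = (1 / 2) ^ card A"
proof -
  have fin: "finite A" using assms finite_subset by blast
  have "subset_mean B (\<lambda>S. of_bool (A \<subseteq> S)) = subset_mean B (\<lambda>S. \<Prod>x\<in>A. of_bool (x \<in> S))"
  proof (rule subset_mean_cong)
    fix S
    show "of_bool (A \<subseteq> S) = (\<Prod>x\<in>A. of_bool (x \<in> S) :: real)"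
    proof (cases "A \<subseteq> S")
      case True
      then show ?thesis by (subst prod.neutral) auto
    next
      case False
      then obtain a where "a \<in> A" "a \<notin> S" by blast
      then show ?thesis using False fin by (subst prod_zero) auto
    qed
  qed
  also have "\<dots> = (\<Prod>x\<in>A. subset_mean B (\<lambda>S. of_bool (x \<in> S)))"
    by (rule conjunct1[OF subset_mean_prod_indep[where D="\<lambda>x. {x}"]])
       (use assms fin in \<open>auto simp: disjoint_family_on_def depends_on_def\<close>)
  also have "\<dots> = (\<Prod>x\<in>A. 1 / 2)"
  proof (rule prod.cong)
    fix x assume "x \<in> A"
    then show "subset_mean B (\<lambda>S. of_bool (x \<in> S)) = 1 / 2"
      using assms by (intro subset_mean_mem) auto
  qed simp
  finally show ?thesis by simp
qed

text \<open>
  Orthogonality of characters: toggling one element of \<open>A\<close> in \<open>S\<close> flips the sign.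
\<close>

lemma subset_mean_character:
  assumes "finite B" "A \<subseteq> B"
  shows "subset_mean B (\<lambda>S. (- 1) ^ card (A - S)) = of_bool (A = {})"
proof (cases "A = {}")
  case False
  then obtain a where a: "a \<in> A" by blast
  define C where "C = B - {a}"
  have C: "finite C" "a \<notin> C" "B = insert a C" using assms a by (auto simp: C_def)
  have "subset_mean C (\<lambda>S. (- 1) ^ card (A - S)) = subset_mean C (\<lambda>S. (- 1) * (- 1) ^ card (A - insert a S))"
  proof (rule subset_mean_cong)
    fix S assume S: "S \<subseteq> C"
    have "A - S = insert a (A - insert a S)" using a S C by auto
    moreover have "finite (A - insert a S)" using assms finite_subset by blast
    ultimately have "card (A - S) = Suc (card (A - insert a S))" by (metis DiffD2 card_insert_disjoint insertI1)
    then show "(- 1) ^ card (A - S) = (- 1) * (- 1 :: real) ^ card (A - insert a S)" by simp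
  qed
  then show ?thesis using C False subset_mean_cmult[of C "- 1" "\<lambda>S. (- 1) ^ card (A - insert a S)"]
    by (simp add: subset_mean_insert)
qed (simp add: subset_mean_const assms)

section \<open>The ratio recursion in the angle coordinate\<close>

text \<open>
  Inverse of \<open>\<gamma> \<mapsto> sin (\<gamma> - \<theta>) / sin \<gamma> = cos \<theta> - sin \<theta> * cot \<gamma>\<close> on the interval from \<open>0\<close> to \<open>pi\<close>. Writing
  it with the arctangent avoids any singularity at the point where the cotangent vanishes.
\<close>

definition angle :: "real \<Rightarrow> real \<Rightarrow> real" where
  "angle \<theta> u = pi / 2 + arctan ((u - cos \<theta>) / sin \<theta>)"

definition ratio :: "real \<Rightarrow> real \<Rightarrow> real" where
  "ratio \<theta> \<gamma> = sin (\<gamma> - \<theta>) / sin \<gamma>"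

lemma angle_gt_0: "0 < angle \<theta> u" and angle_lt_pi: "angle \<theta> u < pi"
  using arctan_bounded[of "(u - cos \<theta>) / sin \<theta>"] by (auto simp: angle_def)

lemma ratio_eq: "sin \<gamma> \<noteq> 0 \<Longrightarrow> ratio \<theta> \<gamma> = cos \<theta> - sin \<theta> * (cos \<gamma> / sin \<gamma>)"
  by (simp add: ratio_def sin_diff field_simps)

lemma angle_ratio:
  assumes "0 < \<theta>" "\<theta> < pi" "0 < \<gamma>" "\<gamma> < pi"
  shows "angle \<theta> (ratio \<theta> \<gamma>) = \<gamma>"
proof -
  have s: "sin \<theta> > 0" "sin \<gamma> > 0" using assms by (auto intro: sin_gt_zero)
  have "(ratio \<theta> \<gamma> - cos \<theta>) / sin \<theta> = - (cos \<gamma> / sin \<gamma>)"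
    using s by (simp add: ratio_eq)
  also have "\<dots> = tan (\<gamma> - pi / 2)"
    by (simp add: tan_def sin_diff cos_diff)
  finally show ?thesis using assms by (simp add: angle_def arctan_tan)
qed

lemma ratio_angle:
  assumes "0 < \<theta>" "\<theta> < pi"
  shows "ratio \<theta> (angle \<theta> u) = u"
proof -
  have s: "sin \<theta> > 0" using assms by (auto intro: sin_gt_zero)
  define a where "a = arctan ((u - cos \<theta>) / sin \<theta>)"
  have c: "cos a > 0" unfolding a_def using arctan_bounded by (intro cos_gt_zero_pi) auto
  have "sin a / cos a = (u - cos \<theta>) / sin \<theta>"
    using tan_arctan[of "(u - cos \<theta>) / sin \<theta>"] by (simp add: tan_def a_def)
  then have "sin \<theta> * sin a = (u - cos \<theta>) * cos a" using s c by (simp add: field_simps)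
  moreover have "ratio \<theta> (pi / 2 + a) = cos (a - \<theta>) / cos a"
    unfolding ratio_def using sin_add[of "pi / 2" "a - \<theta>"] sin_add[of "pi / 2" a]
    by (simp add: algebra_simps)
  ultimately show ?thesis using c
    by (simp add: angle_def a_def[symmetric] cos_diff field_simps)
qed

lemma angle_mono:
  assumes "0 < \<theta>" "\<theta> < pi"
  shows "u \<le> v \<Longrightarrow> angle \<theta> u \<le> angle \<theta> v"
  using sin_gt_zero[OF assms] by (simp add: angle_def arctan_le_iff divide_right_mono)

lemma angle_less_iff:
  assumes "0 < \<theta>" "\<theta> < pi"
  shows "angle \<theta> u < angle \<theta> v \<longleftrightarrow> u < v"
  using sin_gt_zero[OF assms] by (simp add: angle_def arctan_less_iff divide_less_cancel)

text \<open>
  The recursion map is a rotation by \<open>\<theta>\<close> in the angle coordinate, because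
  \<open>2 * cos \<theta> * sin \<gamma> - sin (\<gamma> - \<theta>) = sin (\<gamma> + \<theta>)\<close>.
\<close>

lemma angle_step:
  assumes "0 < \<theta>" "\<theta> < pi" "angle \<theta> t + \<theta> < pi"
  shows "1 / (2 * cos \<theta> - t) = ratio \<theta> (angle \<theta> t + \<theta>)" "t < 2 * cos \<theta>"
proof -
  define \<gamma> where "\<gamma> = angle \<theta> t"
  have s: "sin \<gamma> > 0" "sin (\<gamma> + \<theta>) > 0"
    using assms angle_gt_0[of \<theta> t] angle_lt_pi[of \<theta> t] by (auto intro!: sin_gt_zero simp: \<gamma>_def)
  have "t = sin (\<gamma> - \<theta>) / sin \<gamma>"
    using ratio_angle[OF assms(1,2), of t] by (simp add: ratio_def \<gamma>_def)
  then have "2 * cos \<theta> - t = sin (\<gamma> + \<theta>) / sin \<gamma>"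
    using s by (simp add: sin_diff sin_add field_simps)
  then show "1 / (2 * cos \<theta> - t) = ratio \<theta> (angle \<theta> t + \<theta>)" "t < 2 * cos \<theta>"
    using s by (auto simp: ratio_def \<gamma>_def[symmetric] zero_less_divide_iff dest: arg_cong[of _ _ "\<lambda>x. x > 0"])
qed

text \<open>
  The recursion map, stopped at the ratio that belongs to the angle \<open>\<gamma>\<close>. The cap keeps all ratios in the
  range where the weight below is convex; a vertex that attains it counts as bad.
\<close>

definition capped_step :: "real \<Rightarrow> real \<Rightarrow> real \<Rightarrow> real" where
  "capped_step \<theta> \<gamma> t = (if angle \<theta> t + \<theta> < \<gamma> then 1 / (2 * cos \<theta> - t) else ratio \<theta> \<gamma>)"

lemma capped_step_props:
  assumes "0 < \<theta>" "\<theta> < \<gamma>" "\<gamma> < pi"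
  shows "angle \<theta> (capped_step \<theta> \<gamma> t) \<le> angle \<theta> t + \<theta>"
    and "capped_step \<theta> \<gamma> t \<le> ratio \<theta> \<gamma>" and "0 < capped_step \<theta> \<gamma> t"
    and "capped_step \<theta> \<gamma> t < ratio \<theta> \<gamma> \<Longrightarrow>
      capped_step \<theta> \<gamma> t = 1 / (2 * cos \<theta> - t) \<and> t < 2 * cos \<theta>"
proof -
  have th: "\<theta> < pi" using assms by simp
  note g = angle_gt_0[of \<theta> t] angle_lt_pi[of \<theta> t]
  have r: "0 < ratio \<theta> \<gamma>"
    unfolding ratio_def using assms by (intro divide_pos_pos sin_gt_zero) auto
  have "angle \<theta> (capped_step \<theta> \<gamma> t) \<le> angle \<theta> t + \<theta> \<and> capped_step \<theta> \<gamma> t \<le> ratio \<theta> \<gamma>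
      \<and> 0 < capped_step \<theta> \<gamma> t \<and> (capped_step \<theta> \<gamma> t < ratio \<theta> \<gamma> \<longrightarrow>
      capped_step \<theta> \<gamma> t = 1 / (2 * cos \<theta> - t) \<and> t < 2 * cos \<theta>)"
  proof (cases "angle \<theta> t + \<theta> < \<gamma>")
    case True
    then have lt: "angle \<theta> t + \<theta> < pi" using assms by simp
    note st = angle_step[OF assms(1) th lt]
    have a: "angle \<theta> (capped_step \<theta> \<gamma> t) = angle \<theta> t + \<theta>"
      using True st angle_ratio[OF assms(1) th, of "angle \<theta> t + \<theta>"] g lt assms
      by (simp add: capped_step_def)
    moreover have "angle \<theta> (ratio \<theta> \<gamma>) = \<gamma>" using angle_ratio[OF assms(1) th] assms by simp
    ultimately have "capped_step \<theta> \<gamma> t < ratio \<theta> \<gamma>"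
      using True angle_less_iff[OF assms(1) th] by metis
    moreover have "0 < ratio \<theta> (angle \<theta> t + \<theta>)"
      unfolding ratio_def using g lt assms by (intro divide_pos_pos sin_gt_zero) auto
    ultimately show ?thesis using a st True by (simp add: capped_step_def)
  next
    case False
    moreover have "angle \<theta> (ratio \<theta> \<gamma>) = \<gamma>" using angle_ratio[OF assms(1) th] assms by simp
    ultimately show ?thesis using r by (simp add: capped_step_def)
  qed
  then show "angle \<theta> (capped_step \<theta> \<gamma> t) \<le> angle \<theta> t + \<theta>"
    and "capped_step \<theta> \<gamma> t \<le> ratio \<theta> \<gamma>" and "0 < capped_step \<theta> \<gamma> t"
    and "capped_step \<theta> \<gamma> t < ratio \<theta> \<gamma> \<Longrightarrow>
      capped_step \<theta> \<gamma> t = 1 / (2 * cos \<theta> - t) \<and> t < 2 * cos \<theta>" by auto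
qed

text \<open>
  For \<open>L = ln b\<close> this is \<open>b powr (angle/\<theta>)\<close>, so a rotation by \<open>\<theta>\<close> multiplies it by \<open>b\<close>.
\<close>

definition weight :: "real \<Rightarrow> real \<Rightarrow> real \<Rightarrow> real" where
  "weight L \<theta> u = exp (L * angle \<theta> u / \<theta>)"

lemma mult_cos_le_sin:
  assumes "0 < x" "x < pi / 2"
  shows "x * cos x \<le> sin x"
proof -
  have "x \<le> tan x"
    using abs_tan_ge[of x] tan_gt_zero[of x] assms by simp
  then show ?thesis unfolding tan_def using cos_gt_zero[OF assms] by (metis pos_le_divide_eq)
qed

text \<open>
  The derivative has the sign of \<open>(L/\<theta>) * sin z + 2 * cos z\<close>. It is non-negative as long as \<open>z\<close> keeps
  a distance of at least \<open>2 * \<theta> / L\<close> from \<open>pi\<close>, since \<open>tan \<delta> \<ge> \<delta>\<close>.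
\<close>

lemma exp_sin_sq_mono:
  assumes "0 < \<theta>" "2 / 3 \<le> L" "0 < x" "x \<le> y" "y \<le> pi - 3 * \<theta>"
  shows "exp (L * x / \<theta>) * (sin x)\<^sup>2 \<le> exp (L * y / \<theta>) * (sin y)\<^sup>2"
proof (rule DERIV_nonneg_imp_nondecreasing[OF assms(4)])
  fix z assume z: "x \<le> z" "z \<le> y"
  have d: "((\<lambda>x. exp (L * x / \<theta>) * (sin x)\<^sup>2) has_real_derivative
      exp (L * z / \<theta>) * sin z * (L / \<theta> * sin z + 2 * cos z)) (at z)"
    using assms(1) by (auto intro!: derivative_eq_intros simp: algebra_simps power2_eq_square)
  have s: "sin z > 0" using z assms by (intro sin_gt_zero) auto
  have "L / \<theta> * sin z + 2 * cos z \<ge> 0"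
  proof (cases "z \<le> pi / 2")
    case True
    then have "cos z \<ge> 0" using z assms by (intro cos_ge_zero) auto
    then show ?thesis using s assms by simp
  next
    case False
    define \<delta> where "\<delta> = pi - z"
    have \<delta>: "0 < \<delta>" "\<delta> < pi / 2" "3 * \<theta> \<le> \<delta>" using False z assms by (auto simp: \<delta>_def)
    have c: "cos \<delta> > 0" using \<delta> by (intro cos_gt_zero) auto
    have "3 * \<theta> * cos \<delta> \<le> \<delta> * cos \<delta>" using \<delta>(3) c by (intro mult_right_mono) auto
    also have "\<dots> \<le> sin \<delta>" by (rule mult_cos_le_sin[OF \<delta>(1,2)])
    finally have "3 * \<theta> * cos \<delta> \<le> sin \<delta>" .
    then have "2 * cos \<delta> \<le> (2 / 3) / \<theta> * sin \<delta>" using assms(1) by (simp add: field_simps)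
    also have "\<dots> \<le> L / \<theta> * sin \<delta>"
      using assms s by (intro mult_right_mono divide_right_mono) (auto simp: \<delta>_def)
    finally show ?thesis by (simp add: \<delta>_def)
  qed
  then show "\<exists>D. ((\<lambda>x. exp (L * x / \<theta>) * (sin x)\<^sup>2) has_real_derivative D) (at z) \<and> 0 \<le> D"
    using s by (intro exI[of _ "exp (L * z / \<theta>) * sin z * (L / \<theta> * sin z + 2 * cos z)"] conjI d) simp
qed

text \<open>
  In the angle coordinate the derivative of the weight is a constant multiple of
  \<open>exp (L * \<gamma> / \<theta>) * (sin \<gamma>)^2\<close>, which was just shown to increase.
\<close>

lemma convex_weight:
  assumes "0 < \<theta>" "\<theta> < pi" "2 / 3 \<le> L"
  shows "convex_on {u. angle \<theta> u \<le> pi - 3 * \<theta>} (weight L \<theta>)"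
proof (rule convex_on_realI)
  have s: "sin \<theta> > 0" using assms by (intro sin_gt_zero) auto
  show "connected {u. angle \<theta> u \<le> pi - 3 * \<theta>}"
    unfolding connected_iff_interval
    using angle_mono[OF assms(1,2)] by (metis (no_types, lifting) mem_Collect_eq order_trans)
  let ?f' = "\<lambda>u. L / (\<theta> * sin \<theta>) * (exp (L * angle \<theta> u / \<theta>) * (sin (angle \<theta> u))\<^sup>2)"
  show "(weight L \<theta> has_real_derivative ?f' u) (at u)" for u
  proof -
    define X where "X = (u - cos \<theta>) / sin \<theta>"
    have "sin (angle \<theta> u) = cos (arctan X)"
      by (simp add: angle_def X_def sin_add)
    then have sq: "(sin (angle \<theta> u))\<^sup>2 = 1 / (1 + X\<^sup>2)"
      by (simp add: cos_arctan power_divide)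
    have "(angle \<theta> has_real_derivative (1 / sin \<theta>) * (1 / (1 + X\<^sup>2))) (at u)"
    proof -
      have "((\<lambda>u. (u - cos \<theta>) / sin \<theta>) has_real_derivative 1 / sin \<theta>) (at u)"
        using s by (auto intro!: derivative_eq_intros)
      from DERIV_chain2[OF DERIV_arctan this] show ?thesis
        unfolding angle_def X_def using s by (auto intro!: derivative_eq_intros simp: inverse_eq_divide)
    qed
    then have "(weight L \<theta> has_real_derivative
        exp (L * angle \<theta> u / \<theta>) * (L / \<theta> * ((1 / sin \<theta>) * (1 / (1 + X\<^sup>2))))) (at u)"
      unfolding weight_def using assms by (auto intro!: derivative_eq_intros)
    then show ?thesis by (simp add: sq field_simps)
  qed
  show "?f' x \<le> ?f' y" if "x \<in> {u. angle \<theta> u \<le> pi - 3 * \<theta>}" "y \<in> {u. angle \<theta> u \<le> pi - 3 * \<theta>}" "x \<le> y" for x y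
    using that assms s angle_gt_0[of \<theta> x] angle_mono[OF assms(1,2) that(3)]
    by (intro mult_left_mono exp_sin_sq_mono) auto
qed

text \<open>
  The step multiplies the weight of the average by at most \<open>b\<close>, and by convexity \<open>b\<close> times the weight
  of an average of \<open>b\<close> numbers is at most the sum of their weights. This additivity over the children is what makes
  exponential moments propagate along the tree.
\<close>

lemma weight_capped_step_le_sum:
  assumes "0 < \<theta>" "\<theta> < \<gamma>" "\<gamma> \<le> pi - 3 * \<theta>" "finite I" "card I = b" "b \<ge> 2"
    and v: "\<And>i. i \<in> I \<Longrightarrow> v i \<le> ratio \<theta> \<gamma>"
  shows "weight (ln b) \<theta> (capped_step \<theta> \<gamma> ((\<Sum>i\<in>I. v i) / b)) \<le> (\<Sum>i\<in>I. weight (ln b) \<theta> (v i))"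
proof -
  let ?L = "ln (real b)" and ?t = "(\<Sum>i\<in>I. v i) / real b"
  have th: "\<theta> < pi" "\<gamma> < pi" using assms by auto
  have "ln 2 \<le> ?L" using assms by simp
  then have L: "2 / 3 \<le> ?L" using ln2_ge_two_thirds by linarith
  have I: "I \<noteq> {}" using assms by auto
  have "weight ?L \<theta> (\<Sum>i\<in>I. (1 / real b) *\<^sub>R v i) \<le> (\<Sum>i\<in>I. (1 / real b) * weight ?L \<theta> (v i))"
  proof (rule convex_on_sum[OF assms(4) I convex_weight[OF assms(1) th(1) L]])
    show "v i \<in> {u. angle \<theta> u \<le> pi - 3 * \<theta>}" if "i \<in> I" for i
      using angle_mono[OF assms(1) th(1) v[OF that]] angle_ratio[OF assms(1) th(1), of \<gamma>] assms th by auto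
  qed (use assms in auto)
  then have le: "real b * weight ?L \<theta> ?t \<le> (\<Sum>i\<in>I. weight ?L \<theta> (v i))"
    using assms by (simp add: sum_distrib_left[symmetric] sum_divide_distrib[symmetric] field_simps)
  have "weight ?L \<theta> (capped_step \<theta> \<gamma> ?t) \<le> exp (?L * (angle \<theta> ?t + \<theta>) / \<theta>)"
    unfolding weight_def using capped_step_props(1)[OF assms(1,2) th(2), of ?t] assms(1) L
    by (simp add: divide_right_mono mult_left_mono)
  also have "\<dots> = real b * weight ?L \<theta> ?t"
    using assms by (simp add: weight_def add_divide_distrib distrib_left exp_add)
  finally show ?thesis using le by linarith
qed

text \<open>
  Used at both ends of the range: for the ratio at the cap angle, which is close to \<open>pi\<close>, and for the
  ratio at angles of order \<open>\<theta>\<close>.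
\<close>

lemma sin_mult_cot_le:
  assumes "0 < \<theta>" "0 < C" "C * \<theta> < pi / 2"
  shows "sin \<theta> * (cos (C * \<theta>) / sin (C * \<theta>)) \<le> 1 / C"
proof -
  have p: "0 < C * \<theta>" using assms by simp
  have lt: "C * \<theta> < pi" using assms pi_gt_zero by linarith
  have s: "sin (C * \<theta>) > 0" "cos (C * \<theta>) > 0"
    using sin_gt_zero[OF p lt] cos_gt_zero[OF p assms(3)] by auto
  have "sin \<theta> * cos (C * \<theta>) \<le> \<theta> * cos (C * \<theta>)"
    using s sin_x_le_x[of \<theta>] assms by (intro mult_right_mono) auto
  also have "\<dots> \<le> sin (C * \<theta>) / C"
    using mult_cos_le_sin[OF p assms(3)] assms(2) by (simp add: field_simps)
  finally show ?thesis using s assms by (simp add: field_simps)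
qed

lemma ratio_cap_le:
  assumes "0 < \<theta>" "0 < C" "C * \<theta> < pi / 2"
  shows "ratio \<theta> (pi - C * \<theta>) \<le> 1 + 1 / C"
proof -
  have "0 < C * \<theta>" "C * \<theta> < pi" using assms pi_gt_zero by (simp, linarith)
  then have "sin (C * \<theta>) > 0" by (rule sin_gt_zero)
  then have "ratio \<theta> (pi - C * \<theta>) = cos \<theta> + sin \<theta> * (cos (C * \<theta>) / sin (C * \<theta>))"
    by (subst ratio_eq) auto
  then show ?thesis using sin_mult_cot_le[OF assms] cos_le_one[of \<theta>] by linarith
qed

lemma angle_le_of_le:
  assumes "0 < \<theta>" "0 < C" "C * \<theta> < pi / 2" "\<theta> < pi" "t \<le> cos \<theta> - 1 / C"
  shows "angle \<theta> t \<le> C * \<theta>"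
proof -
  have p: "0 < C * \<theta>" using assms by simp
  have lt: "C * \<theta> < pi" using assms pi_gt_zero by linarith
  have "sin (C * \<theta>) > 0" using p lt by (rule sin_gt_zero)
  then have "t \<le> ratio \<theta> (C * \<theta>)"
    using sin_mult_cot_le[OF assms(1-3)] assms(5) by (subst ratio_eq) auto
  then have "angle \<theta> t \<le> angle \<theta> (ratio \<theta> (C * \<theta>))" by (rule angle_mono[OF assms(1,4)])
  then show ?thesis using angle_ratio[OF assms(1,4) p lt] by simp
qed

section \<open>Killed walks and the lamplighter\<close>

context rooted_tree begin

text \<open>
  Transition operator of the simple random walk killed outside \<open>S\<close>.
\<close>

definition killed :: "'v set \<Rightarrow> ('v \<Rightarrow> real) \<Rightarrow> 'v \<Rightarrow> real" where
  "killed S f x = (if x \<in> S then (\<Sum>y\<in>{y. E x y} \<inter> S. f y) / Suc b else 0)"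

abbreviation at_root :: "'v \<Rightarrow> real" where
  "at_root x \<equiv> of_bool (x = rt)"

definition killed_return :: "'v set \<Rightarrow> nat \<Rightarrow> real" where
  "killed_return S n = (killed S ^^ n) at_root rt"

lemma killed_mono:
  assumes "A \<subseteq> S" "\<And>y. y \<in> S \<Longrightarrow> 0 \<le> g y" "\<And>y. y \<in> A \<Longrightarrow> f y \<le> g y"
  shows "killed A f x \<le> killed S g x"
proof (cases "x \<in> A")
  case True
  have "(\<Sum>y\<in>{y. E x y} \<inter> A. f y) \<le> (\<Sum>y\<in>{y. E x y} \<inter> A. g y)"
    using assms by (intro sum_mono) auto
  also have "\<dots> \<le> (\<Sum>y\<in>{y. E x y} \<inter> S. g y)"
    using assms finite_nbrs[of x] by (intro sum_mono2) auto
  finally show ?thesis using True assms(1) by (auto simp: killed_def divide_right_mono)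
next
  case False
  have "0 \<le> (\<Sum>y\<in>{y. E x y} \<inter> S. g y)" using assms by (intro sum_nonneg) auto
  then show ?thesis using False by (simp add: killed_def)
qed

lemma killed_iter_nonneg: "(\<And>y. 0 \<le> f y) \<Longrightarrow> 0 \<le> (killed S ^^ n) f x"
  by (induction n arbitrary: x) (auto simp: killed_def intro!: sum_nonneg divide_nonneg_nonneg)

lemma killed_iter_mono:
  assumes "A \<subseteq> S" "\<And>y. 0 \<le> f y"
  shows "(killed A ^^ n) f x \<le> (killed S ^^ n) f x"
proof (induction n arbitrary: x)
  case (Suc n)
  show ?case
    using killed_mono[OF assms(1), of "(killed S ^^ n) f" "(killed A ^^ n) f" x]
      killed_iter_nonneg[of f] assms(2) Suc by simp
qed simp

lemma killed_return_nonneg: "0 \<le> killed_return S n"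
  unfolding killed_return_def by (rule killed_iter_nonneg) simp

lemma killed_return_mono: "A \<subseteq> S \<Longrightarrow> killed_return A n \<le> killed_return S n"
  unfolding killed_return_def by (rule killed_iter_mono) auto

text \<open>
  A positive supersolution at level \<open>\<mu>\<close>, normalised at the root, dominates the iterates of the indicator
  of the root up to the factor \<open>\<mu> ^ n\<close>.
\<close>

lemma killed_return_le_power:
  assumes "\<And>x. 0 \<le> g x" "g rt = 1" "0 \<le> \<mu>" "\<And>x. x \<in> S \<Longrightarrow> killed S g x \<le> \<mu> * g x"
  shows "killed_return S n \<le> \<mu> ^ n"
proof -
  have "(killed S ^^ n) at_root x \<le> \<mu> ^ n * g x" for x
  proof (induction n arbitrary: x)
    case 0
    show ?case using assms(1,2) by auto
  next
    case (Suc n)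
    have "(killed S ^^ Suc n) at_root x \<le> killed S (\<lambda>y. \<mu> ^ n * g y) x"
      using killed_mono[OF order_refl, of S "\<lambda>y. \<mu> ^ n * g y" "(killed S ^^ n) at_root" x]
        Suc assms by simp
    also have "\<dots> = \<mu> ^ n * killed S g x"
      by (simp add: killed_def sum_distrib_left)
    also have "\<dots> \<le> \<mu> ^ n * (\<mu> * g x)"
    proof (rule mult_left_mono)
      show "killed S g x \<le> \<mu> * g x"
        using assms by (cases "x \<in> S") (auto simp: killed_def simp del: of_nat_Suc)
    qed (use assms in simp)
    finally show ?case by (simp add: mult_ac)
  qed
  from this[of rt] show ?thesis using assms(2) by (simp add: killed_return_def)
qed

lemma killed_self_adjoint:
  assumes "finite A"
  shows "(\<Sum>x\<in>A. f x * killed A g x) = (\<Sum>x\<in>A. killed A f x * g x)"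
proof -
  have eq: "{y. E x y} \<inter> A = {y \<in> A. E x y}" for x by auto
  have "(\<Sum>x\<in>A. f x * killed A g x) = (\<Sum>x\<in>A. \<Sum>y\<in>{y\<in>A. E x y}. f x * g y / Suc b)"
    by (simp add: killed_def eq sum_distrib_left sum_divide_distrib)
  also have "\<dots> = (\<Sum>y\<in>A. \<Sum>x\<in>{x\<in>A. E x y}. f x * g y / Suc b)"
    by (rule sum.swap_restrict[OF assms assms])
  also have "\<dots> = (\<Sum>y\<in>A. killed A f y * g y)"
    by (simp add: killed_def eq sum_distrib_right sum_divide_distrib E_sym)
  finally show ?thesis .
qed

lemma killed_iter_self_adjoint:
  assumes "finite A"
  shows "(\<Sum>x\<in>A. f x * (killed A ^^ n) g x) = (\<Sum>x\<in>A. (killed A ^^ n) f x * g x)"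
proof (induction n arbitrary: g)
  case (Suc n)
  have "(\<Sum>x\<in>A. f x * (killed A ^^ Suc n) g x) = (\<Sum>x\<in>A. f x * (killed A ^^ n) (killed A g) x)"
    by (simp add: funpow_swap1)
  also have "\<dots> = (\<Sum>x\<in>A. (killed A ^^ n) f x * killed A g x)" by (rule Suc)
  also have "\<dots> = (\<Sum>x\<in>A. (killed A ^^ Suc n) f x * g x)"
    by (simp add: killed_self_adjoint[OF assms])
  finally show ?case .
qed simp

text \<open>
  By self-adjointness the return probability at time \<open>2 * m\<close> is the squared norm of the \<open>m\<close>-th iterate
  of the indicator of the root. Cauchy's inequality against a subsolution \<open>f\<close> bounds it from below.
\<close>

lemma killed_return_ge_power:
  assumes A: "finite A" "rt \<in> A" and f: "\<And>x. 0 \<le> f x" and "0 \<le> \<mu>"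
    and sub: "\<And>x. x \<in> A \<Longrightarrow> \<mu> * f x \<le> killed A f x"
  shows "(\<mu> ^ m * f rt)\<^sup>2 \<le> killed_return A (2 * m) * (\<Sum>x\<in>A. (f x)\<^sup>2)"
proof -
  have pick: "(\<Sum>x\<in>A. at_root x * h x) = h rt" for h :: "'v \<Rightarrow> real"
  proof -
    have "(\<Sum>x\<in>A. at_root x * h x) = (\<Sum>x\<in>A. if x = rt then h x else 0)"
      by (intro sum.cong) auto
    then show ?thesis using A by (simp add: sum.delta)
  qed
  let ?u = "(killed A ^^ m) at_root"
  have "killed_return A (2 * m) = (\<Sum>x\<in>A. at_root x * (killed A ^^ m) ?u x)"
    unfolding pick killed_return_def by (simp add: mult_2 funpow_add)
  also have "\<dots> = (\<Sum>x\<in>A. ?u x * ?u x)" by (rule killed_iter_self_adjoint[OF A(1)])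
  finally have ret: "killed_return A (2 * m) = (\<Sum>x\<in>A. (?u x)\<^sup>2)" by (simp add: power2_eq_square)
  have "\<mu> ^ m * f x \<le> (killed A ^^ m) f x" if "x \<in> A" for x
    using that
  proof (induction m arbitrary: x)
    case (Suc m)
    have "\<mu> ^ Suc m * f x \<le> \<mu> ^ m * killed A f x"
      using mult_left_mono[OF sub[OF Suc.prems], of "\<mu> ^ m"] assms(4) by (simp add: mult_ac)
    also have "\<dots> = killed A (\<lambda>y. \<mu> ^ m * f y) x"
      by (simp add: killed_def sum_distrib_left)
    also have "\<dots> \<le> killed A ((killed A ^^ m) f) x"
      using Suc.IH killed_iter_nonneg[of f] f by (intro killed_mono) auto
    finally show ?case by simp
  qed simp
  then have "\<mu> ^ m * f rt \<le> (\<Sum>x\<in>A. at_root x * (killed A ^^ m) f x)"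
    unfolding pick using A by simp
  also have "\<dots> = (\<Sum>x\<in>A. ?u x * f x)" by (rule killed_iter_self_adjoint[OF A(1)])
  finally have "(\<mu> ^ m * f rt)\<^sup>2 \<le> (\<Sum>x\<in>A. ?u x * f x)\<^sup>2"
    using assms(4) f by (intro power_mono) auto
  also have "\<dots> \<le> (\<Sum>x\<in>A. (?u x)\<^sup>2) * (\<Sum>x\<in>A. (f x)\<^sup>2)" by (rule Cauchy_Schwarz_ineq_sum)
  finally show ?thesis by (simp add: ret)
qed

lemma sum_nbrs_radial:
  fixes F :: "nat \<Rightarrow> real"
  shows "(\<Sum>y\<in>{y. E x y}. F (dep y)) =
    (if x = rt then Suc b * F 1 else F (dep x - 1) + b * F (Suc (dep x)))"
proof -
  have c: "(\<Sum>y\<in>ch x. F (dep y)) = card (ch x) * F (Suc (dep x))"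
    by (simp add: dep_ch)
  show ?thesis
  proof (cases "x = rt")
    case True
    then show ?thesis using c by (simp add: nbrs_rt card_ch dep_rt)
  next
    case False
    then show ?thesis
      using c dep_par[OF False] finite_ch par_notin_ch[OF False] by (simp add: nbrs_insert card_ch)
  qed
qed

text \<open>
  The function \<open>b powr (- dep x / 2)\<close> is harmonic at level \<open>rho\<close> away from the root and superharmonic at
  the root.
\<close>

lemma killed_return_UNIV_le: "killed_return UNIV n \<le> rho (Suc b) ^ n"
proof (rule killed_return_le_power[where g="\<lambda>x. (1 / sqrt b) ^ dep x"])
  define s where "s = 1 / sqrt (real b)"
  have s: "s > 0" "b * s\<^sup>2 = 1" "sqrt b = 1 / s" using b_ge by (auto simp: s_def power_divide)
  have "killed UNIV (\<lambda>x. s ^ dep x) x \<le> rho (Suc b) * s ^ dep x" for x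
  proof (cases "x = rt")
    case True
    have "Suc b * s \<le> 2 * b * s" using b_ge s(1) by (intro mult_right_mono) auto
    also have "\<dots> = 2 / s" using s(1,2) by (simp add: field_simps power2_eq_square)
    finally have "s \<le> 2 / s / Suc b" by (subst pos_le_divide_eq) (auto simp: mult.commute)
    then show ?thesis using True
      by (simp add: killed_def sum_nbrs_radial[of "\<lambda>n. s ^ n"] dep_rt rho_def s(3))
  next
    case False
    obtain j where j: "dep x = Suc j" using False dep_par by blast
    have "b * s ^ Suc (Suc j) = s ^ j"
      using s(2) by (simp add: power2_eq_square mult_ac)
    then have "killed UNIV (\<lambda>x. s ^ dep x) x = (s ^ j + s ^ j) / Suc b"
      using False by (simp add: killed_def sum_nbrs_radial[of "\<lambda>n. s ^ n"] j)
    also have "\<dots> = rho (Suc b) * s ^ dep x" using s(1) by (simp add: rho_def s(3) j)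
    finally show ?thesis by simp
  qed
  then show "killed UNIV (\<lambda>x. (1 / sqrt b) ^ dep x) x \<le> rho (Suc b) * (1 / sqrt b) ^ dep x" for x
    by (simp add: s_def)
qed (auto simp: dep_rt rho_def)

text \<open>
  The sine profile vanishes at depth \<open>r + 1\<close>, so killing outside the ball does not affect it. Away from the root it
  is an exact eigenfunction; at the root, which has one child more than the other vertices, it is still a subsolution.
\<close>

lemma killed_return_root_ball_ge:
  defines "\<theta> \<equiv> \<lambda>r :: nat. pi / (real r + 2)"
  shows "(rho (Suc b) * cos (\<theta> r)) ^ (2 * m) * (sin (\<theta> r))\<^sup>2 / card (root_ball r) \<le> killed_return (root_ball r) (2 * m)"
proof -
  define s where "s = 1 / sqrt (real b)"
  have s: "s > 0" "b * s\<^sup>2 = 1" "sqrt b = 1 / s" "s \<le> 1" using b_ge by (auto simp: s_def power_divide)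
  let ?t = "\<theta> r"
  define F where "F = (\<lambda>j :: nat. s ^ j * sin (real (Suc j) * ?t))"
  define f where "f = (\<lambda>x. if dep x \<le> r then F (dep x) else 0)"
  \<comment> \<open>\<open>(r + 2) * \<theta> = pi\<close>\<close>
  have F_end: "F (Suc r) = 0" by (simp add: F_def \<theta>_def add.commute)
  have F0: "0 \<le> F j" if "j \<le> r" for j
  proof -
    have "real (Suc j) * ?t \<le> (real r + 2) * ?t"
      using that by (intro mult_right_mono) (auto simp: \<theta>_def)
    also have "\<dots> = pi" by (simp add: \<theta>_def)
    finally have "real (Suc j) * ?t \<le> pi" .
    then show ?thesis using s(1) unfolding F_def
      by (intro mult_nonneg_nonneg sin_ge_zero) (auto simp: \<theta>_def)
  qed
  have c0: "0 \<le> cos ?t" "0 \<le> sin ?t"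
  proof -
    have "?t \<le> pi / 2" "0 \<le> ?t" by (auto simp: \<theta>_def field_simps)
    then show "0 \<le> cos ?t" "0 \<le> sin ?t" by (auto intro!: cos_ge_zero sin_ge_zero)
  qed
  have sub: "rho (Suc b) * cos ?t * f x \<le> killed (root_ball r) f x" if x: "x \<in> root_ball r" for x
  proof -
    have "(\<Sum>y\<in>{y. E x y} \<inter> root_ball r. f y) = (\<Sum>y\<in>{y. E x y}. F (dep y))"
    proof (rule sum.mono_neutral_cong_left)
      show "\<forall>y\<in>{y. E x y} - {y. E x y} \<inter> root_ball r. F (dep y) = 0"
      proof
        fix y assume "y \<in> {y. E x y} - {y. E x y} \<inter> root_ball r"
        then have "dep y = Suc r" using dep_nbr[of x y] x by (auto simp: root_ball_def)
        then show "F (dep y) = 0" using F_end by simp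
      qed
    qed (use finite_nbrs in \<open>auto simp: f_def root_ball_def\<close>)
    also have "\<dots> \<ge> 2 / s * cos ?t * f x"
    proof (cases "x = rt")
      case True
      have "sin (2 * ?t) = 2 * sin ?t * cos ?t" by (rule sin_double)
      then have "Suc b * F 1 = Suc b * s * (2 * sin ?t * cos ?t)" by (simp add: F_def)
      also have "\<dots> \<ge> b * s * (2 * sin ?t * cos ?t)"
        using c0 s(1) by (intro mult_right_mono) auto
      also have "b * s = 1 / s" using s by (simp add: field_simps power2_eq_square)
      finally show ?thesis using True sum_nbrs_radial[of F x] by (simp add: f_def F_def dep_rt mult_ac)
    next
      case False
      obtain j where j: "dep x = Suc j" using False dep_par by blast
      have "b * s ^ Suc (Suc j) = s ^ j"
        using s(2) by (simp add: power2_eq_square mult_ac)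
      moreover have "sin (real (Suc j) * ?t) + sin (real (Suc (Suc (Suc j))) * ?t)
          = 2 * cos ?t * sin (real (Suc (Suc j)) * ?t)"
        using sin_add[of "real (Suc (Suc j)) * ?t" ?t] sin_diff[of "real (Suc (Suc j)) * ?t" ?t]
        by (simp add: algebra_simps)
      ultimately have "F j + b * F (Suc (Suc j)) = s ^ j * (2 * cos ?t * sin (real (Suc (Suc j)) * ?t))"
        unfolding F_def by (metis distrib_left mult.assoc)
      also have "\<dots> = 2 / s * cos ?t * F (Suc j)" using s(1) by (simp add: F_def)
      finally show ?thesis using False sum_nbrs_radial[of F x] x j by (simp add: f_def root_ball_def)
    qed
    finally have "2 / s * cos ?t * f x / Suc b \<le> (\<Sum>y\<in>{y. E x y} \<inter> root_ball r. f y) / Suc b"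
      by (rule divide_right_mono) simp
    then show ?thesis using x by (simp add: killed_def rho_def s(3))
  qed
  have "((rho (Suc b) * cos ?t) ^ m * f rt)\<^sup>2 \<le> killed_return (root_ball r) (2 * m) * (\<Sum>x\<in>root_ball r. (f x)\<^sup>2)"
    by (rule killed_return_ge_power) (use card_root_ball c0 F0 sub in \<open>auto simp: f_def root_ball_def dep_rt rho_def\<close>)
  also have "\<dots> \<le> killed_return (root_ball r) (2 * m) * (\<Sum>x\<in>root_ball r. 1)"
  proof (intro mult_left_mono sum_mono killed_return_nonneg)
    fix x
    have "\<bar>F (dep x)\<bar> \<le> 1"
      unfolding F_def abs_mult using s by (intro mult_le_one) (auto simp: power_le_one)
    then show "(f x)\<^sup>2 \<le> 1" by (simp add: f_def abs_square_le_1)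
  qed
  also have "f rt = sin ?t" by (simp add: f_def F_def dep_rt)
  finally have "(rho (Suc b) * cos ?t) ^ (2 * m) * (sin ?t)\<^sup>2 \<le> killed_return (root_ball r) (2 * m) * card (root_ball r)"
    by (simp add: power_mult_distrib power_mult mult_ac power_commutes flip: power_mult)
  moreover have "card (root_ball r) > 0"
    using card_root_ball[of r] card_gt_0_iff[of "root_ball r"] by (auto simp: root_ball_def dep_rt intro: exI[of _ rt])
  ultimately show ?thesis by (simp add: pos_divide_le_eq)
qed

lemma pmf_walk_steps: "pmf (n_steps (walk_step E) n x) rt = (killed UNIV ^^ n) at_root x"
proof (induction n arbitrary: x)
  case (Suc n)
  have ne: "{y. E x y} \<noteq> {}" using card_nbrs[of x] by (metis card.empty nat.distinct(1))
  have "pmf (n_steps (walk_step E) (Suc n) x) rt = (\<Sum>y\<in>{y. E x y}. pmf (n_steps (walk_step E) n y) rt) / Suc b"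
    by (simp only: n_steps.simps walk_step_def[of E x] pmf_bind_pmf_of_set[OF ne finite_nbrs] card_nbrs)
  then show ?case using Suc by (simp add: killed_def)
qed (auto simp: pmf_return)

lemma return_prob_walk: "return_prob (walk_step E) n rt = killed_return UNIV n"
  by (simp add: return_prob_def pmf_walk_steps killed_return_def)

text \<open>
  Averaging over the state of the lamp at \<open>x\<close> kills the character of the complement of \<open>S\<close> unless \<open>x\<close> lies in \<open>S\<close>.
\<close>

lemma sum_character_update:
  fixes \<eta> :: "'v \<Rightarrow>\<^sub>0 bit"
  shows "(\<Sum>a\<in>{0, 1}. (- 1) ^ card (Poly_Mapping.keys (Poly_Mapping.update x a \<eta>) - S)) =
    2 * of_bool (x \<in> S) * (- 1 :: real) ^ card (Poly_Mapping.keys \<eta> - S)"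
proof (cases "x \<in> S")
  case True
  then have "insert x (Poly_Mapping.keys \<eta>) - S = Poly_Mapping.keys \<eta> - S"
    "Poly_Mapping.keys \<eta> - {x} - S = Poly_Mapping.keys \<eta> - S" by auto
  then show ?thesis using True by (simp add: keys_update)
next
  case False
  then have "insert x (Poly_Mapping.keys \<eta>) - S = insert x (Poly_Mapping.keys \<eta> - {x} - S)" by auto
  moreover have "card (insert x (Poly_Mapping.keys \<eta> - {x} - S)) = Suc (card (Poly_Mapping.keys \<eta> - {x} - S))"
    by (intro card_insert_disjoint) auto
  ultimately show ?thesis using False by (simp add: keys_update)
qed

text \<open>
  The sign is the character of the complement of \<open>S\<close> evaluated at the lamp configuration; the set \<open>S\<close>
  consists of the vertices where the character is trivial. The two resampled lamps of one step impose
  \<open>x \<in> S\<close> and \<open>y \<in> S\<close>, which is exactly one step of the killed walk. The ball of radius \<open>N\<close> has to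
  contain every lamp that can be touched.
\<close>

lemma pmf_sws_steps:
  assumes "dep x + n \<le> N" "Poly_Mapping.keys \<eta> \<subseteq> root_ball N"
  shows "pmf (n_steps (sws_step E) n (x, \<eta>)) (rt, 0) =
    subset_mean (root_ball N) (\<lambda>S. (killed S ^^ n) at_root x * (- 1) ^ card (Poly_Mapping.keys \<eta> - S))"
  using assms
proof (induction n arbitrary: x \<eta>)
  case 0
  have "pmf (n_steps (sws_step E) 0 (x, \<eta>)) (rt, 0) = at_root x * of_bool (Poly_Mapping.keys \<eta> = {})"
    by (auto simp: pmf_return)
  also have "\<dots> = subset_mean (root_ball N) (\<lambda>S. at_root x * (- 1) ^ card (Poly_Mapping.keys \<eta> - S))"
    using card_root_ball 0 by (simp only: subset_mean_cmult subset_mean_character)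
  finally show ?case by simp
next
  case (Suc n)
  let ?k = "\<lambda>\<eta> :: 'v \<Rightarrow>\<^sub>0 bit. Poly_Mapping.keys \<eta>" and ?up = Poly_Mapping.update
  have ne: "{y. E x y} \<noteq> {}" using card_nbrs[of x] by (metis card.empty nat.distinct(1))
  have bits: "({0, 1} :: bit set) \<noteq> {}" "finite ({0, 1} :: bit set)" "card ({0, 1} :: bit set) = 2" by auto
  have IH: "pmf (n_steps (sws_step E) n (y, ?up y a' (?up x a \<eta>))) (rt, 0) =
      subset_mean (root_ball N) (\<lambda>S. (killed S ^^ n) at_root y * (- 1) ^ card (?k (?up y a' (?up x a \<eta>)) - S))"
    if "E x y" for y a a'
  proof (rule Suc.IH)
    show "dep y + n \<le> N" using dep_nbr[OF that] Suc.prems by simp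
    then have "y \<in> root_ball N" "x \<in> root_ball N" using Suc.prems by (auto simp: root_ball_def)
    then show "?k (?up y a' (?up x a \<eta>)) \<subseteq> root_ball N" using Suc.prems by (auto simp: keys_update split: if_splits)
  qed
  have "pmf (n_steps (sws_step E) (Suc n) (x, \<eta>)) (rt, 0) =
      (\<Sum>a\<in>{0, 1}. (\<Sum>y\<in>{y. E x y}. (\<Sum>a'\<in>{0, 1}.
        pmf (n_steps (sws_step E) n (y, ?up y a' (?up x a \<eta>))) (rt, 0)) / 2) / Suc b) / 2"
    unfolding n_steps.simps sws_step_def prod.case resample_lamp_def walk_step_def map_pmf_def
      bind_assoc_pmf bind_return_pmf pmf_bind_pmf_of_set[OF bits(1,2)] bits(3)
      pmf_bind_pmf_of_set[OF ne finite_nbrs] card_nbrs of_nat_numeral by (rule refl)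
  also have "\<dots> = (\<Sum>a\<in>{0, 1}. (\<Sum>y\<in>{y. E x y}. (\<Sum>a'\<in>{0, 1}. subset_mean (root_ball N)
      (\<lambda>S. (killed S ^^ n) at_root y * (- 1) ^ card (?k (?up y a' (?up x a \<eta>)) - S))) / 2) / Suc b) / 2"
    using IH by (intro arg_cong2[where f="(/)"] sum.cong refl) auto
  also have "\<dots> = subset_mean (root_ball N) (\<lambda>S. (\<Sum>a\<in>{0, 1}. (\<Sum>y\<in>{y. E x y}. (\<Sum>a'\<in>{0, 1}.
      (killed S ^^ n) at_root y * (- 1) ^ card (?k (?up y a' (?up x a \<eta>)) - S)) / 2) / Suc b) / 2)"
    by (simp only: subset_mean_sum[symmetric] divide_inverse subset_mean_cmult[symmetric] mult.commute[of _ "inverse _"])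
  also have "\<dots> = subset_mean (root_ball N) (\<lambda>S. (killed S ^^ Suc n) at_root x * (- 1) ^ card (?k \<eta> - S))"
  proof (rule subset_mean_cong)
    fix S
    let ?g = "(killed S ^^ n) at_root"
    have "(\<Sum>a\<in>{0, 1}. (\<Sum>y\<in>{y. E x y}. (\<Sum>a'\<in>{0, 1}.
        ?g y * (- 1) ^ card (?k (?up y a' (?up x a \<eta>)) - S)) / 2) / Suc b) / 2 =
      (\<Sum>a\<in>{0, 1}. (\<Sum>y\<in>{y. E x y}. ?g y * of_bool (y \<in> S) * (- 1) ^ card (?k (?up x a \<eta>) - S)) / Suc b) / 2"
      by (simp only: sum_distrib_left[symmetric] sum_character_update) (simp add: mult_ac)
    also have "\<dots> = (\<Sum>y\<in>{y. E x y}. ?g y * of_bool (y \<in> S)) / Suc b *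
        (\<Sum>a\<in>{0, 1}. (- 1) ^ card (?k (?up x a \<eta>) - S)) / 2"
      by (simp only: sum_distrib_right[symmetric] times_divide_eq_left[symmetric] sum_distrib_left[symmetric])
    also have "\<dots> = (\<Sum>y\<in>{y. E x y}. ?g y * of_bool (y \<in> S)) / Suc b * of_bool (x \<in> S) * (- 1) ^ card (?k \<eta> - S)"
      by (simp only: sum_character_update) (simp add: field_simps)
    also have "(\<Sum>y\<in>{y. E x y}. ?g y * of_bool (y \<in> S)) = (\<Sum>y\<in>{y. E x y} \<inter> S. ?g y)"
      using finite_nbrs[of x] by simp
    also have "(\<Sum>y\<in>{y. E x y} \<inter> S. ?g y) / Suc b * of_bool (x \<in> S) * (- 1) ^ card (?k \<eta> - S) =
        (killed S ^^ Suc n) at_root x * (- 1) ^ card (?k \<eta> - S)"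
      by (simp add: killed_def)
    finally show "(\<Sum>a\<in>{0, 1}. (\<Sum>y\<in>{y. E x y}. (\<Sum>a'\<in>{0, 1}.
        ?g y * (- 1) ^ card (?k (?up y a' (?up x a \<eta>)) - S)) / 2) / Suc b) / 2 =
        (killed S ^^ Suc n) at_root x * (- 1) ^ card (?k \<eta> - S)" .
  qed
  finally show ?case .
qed

lemma return_prob_sws:
  assumes "n \<le> N"
  shows "return_prob (sws_step E) n (rt, 0) = subset_mean (root_ball N) (\<lambda>S. killed_return S n)"
  using pmf_sws_steps[of rt n N 0] assms by (simp add: return_prob_def killed_return_def dep_rt)

end

section \<open>Exponential moments of the ratios\<close>

lemma weight_mono: "0 < \<theta> \<Longrightarrow> \<theta> < pi \<Longrightarrow> 0 \<le> L \<Longrightarrow> u \<le> v \<Longrightarrow> weight L \<theta> u \<le> weight L \<theta> v"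
  using angle_mono[of \<theta> u v] by (simp add: weight_def divide_right_mono mult_left_mono)

context rooted_tree begin

text \<open>
  The quotients \<open>u\<close> of the supersolution, computed from \<open>j\<close> generations of descendants.
\<close>

primrec ratio_at :: "real \<Rightarrow> real \<Rightarrow> nat \<Rightarrow> 'v \<Rightarrow> 'v set \<Rightarrow> real" where
  "ratio_at \<theta> \<gamma> 0 x S = 0"
| "ratio_at \<theta> \<gamma> (Suc j) x S =
    (if x \<in> S then capped_step \<theta> \<gamma> ((\<Sum>y\<in>ch x. ratio_at \<theta> \<gamma> j y S) / b) else 0)"

primrec cone :: "nat \<Rightarrow> 'v \<Rightarrow> 'v set" where
  "cone 0 x = {x}"
| "cone (Suc j) x = insert x (\<Union>y\<in>ch x. cone j y)"

lemma cone_ancestor: "w \<in> cone j y \<Longrightarrow> dep y \<le> dep w \<and> (par ^^ (dep w - dep y)) w = y"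
proof (induction j arbitrary: y)
  case (Suc j)
  show ?case
  proof (cases "w = y")
    case False
    then obtain z where z: "z \<in> ch y" "w \<in> cone j z" using Suc.prems by auto
    have le: "dep z \<le> dep w" "(par ^^ (dep w - dep z)) w = z" using Suc.IH[OF z(2)] by auto
    have "dep w - dep y = Suc (dep w - dep z)" using dep_ch[OF z(1)] le by simp
    then have "(par ^^ (dep w - dep y)) w = par z" using le by simp
    then show ?thesis using z(1) le dep_ch[OF z(1)] by (simp add: ch_def)
  qed simp
qed simp

lemma cone_disjoint: "disjoint_family_on (cone j) (ch x)"
  unfolding disjoint_family_on_def
proof (intro ballI impI equals0I)
  fix y z w assume *: "y \<in> ch x" "z \<in> ch x" "y \<noteq> z" "w \<in> cone j y \<inter> cone j z"
  then have "dep y = dep z" using dep_ch[of y x] dep_ch[of z x] by simp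
  then show False using cone_ancestor[of w j y] cone_ancestor[of w j z] * by auto
qed

lemma parent_notin_cone: "x \<notin> (\<Union>y\<in>ch x. cone j y)"
proof
  assume "x \<in> (\<Union>y\<in>ch x. cone j y)"
  then obtain y where "y \<in> ch x" "x \<in> cone j y" by blast
  then show False using cone_ancestor[of x j y] dep_ch[of y x] by simp
qed

lemma in_cone_self: "x \<in> cone j x"
  by (cases j) auto

lemma ratio_at_depends: "depends_on (ratio_at \<theta> \<gamma> j x) (cone j x)"
proof (induction j arbitrary: x)
  case (Suc j)
  have *: "ratio_at \<theta> \<gamma> j y S = ratio_at \<theta> \<gamma> j y (S \<inter> cone (Suc j) x)" if "y \<in> ch x" for y S
  proof -
    have "S \<inter> cone (Suc j) x \<inter> cone j y = S \<inter> cone j y" using that by auto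
    then show ?thesis using Suc[of y] unfolding depends_on_def by metis
  qed
  show ?case
    unfolding depends_on_def
  proof
    fix S
    have "(\<Sum>y\<in>ch x. ratio_at \<theta> \<gamma> j y S) = (\<Sum>y\<in>ch x. ratio_at \<theta> \<gamma> j y (S \<inter> cone (Suc j) x))"
      by (rule sum.cong[OF refl *])
    then show "ratio_at \<theta> \<gamma> (Suc j) x S = ratio_at \<theta> \<gamma> (Suc j) x (S \<inter> cone (Suc j) x)"
      by (simp del: cone.simps) (simp add: in_cone_self del: cone.simps)
  qed
qed (simp add: depends_on_def)

lemma ratio_at_bounds:
  assumes "0 < \<theta>" "\<theta> < \<gamma>" "\<gamma> < pi"
  shows "0 \<le> ratio_at \<theta> \<gamma> j x S" "ratio_at \<theta> \<gamma> j x S \<le> ratio \<theta> \<gamma>"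
proof -
  have "0 < ratio \<theta> \<gamma>"
    unfolding ratio_def using assms by (intro divide_pos_pos sin_gt_zero) auto
  then show "0 \<le> ratio_at \<theta> \<gamma> j x S" "ratio_at \<theta> \<gamma> j x S \<le> ratio \<theta> \<gamma>"
    using capped_step_props(2,3)[OF assms] by (cases j; simp add: less_imp_le)+
qed

text \<open>
  The exponential moment of the weight restricted to open vertices. It vanishes when \<open>x\<close> is closed, so a
  product over the children detects that all of them are open.
\<close>

definition open_weight :: "real \<Rightarrow> real \<Rightarrow> real \<Rightarrow> nat \<Rightarrow> 'v \<Rightarrow> 'v set \<Rightarrow> real" where
  "open_weight K \<theta> \<gamma> j x S = of_bool (x \<in> S) * exp (K * weight (ln b) \<theta> (ratio_at \<theta> \<gamma> j x S))"

lemma open_weight_nonneg: "0 \<le> open_weight K \<theta> \<gamma> j x S"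
  by (simp add: open_weight_def)

lemma open_weight_depends: "depends_on (open_weight K \<theta> \<gamma> j x) (cone j x)"
proof -
  have "depends_on (\<lambda>S. x \<in> S) (cone j x)" using in_cone_self by (simp add: depends_on_def)
  from depends_on_comp2[OF this ratio_at_depends[of \<theta> \<gamma> j x],
      of "\<lambda>p u. of_bool p * exp (K * weight (ln b) \<theta> u)"]
  show ?thesis unfolding open_weight_def .
qed

text \<open>
  If all children are open, additivity of the weight turns the exponential into a product. If one
  child is closed, the average over the children drops by a factor of at least \<open>1 - 1/b\<close> below the cap,
  so the new weight is bounded by a constant that does not depend on \<open>\<theta>\<close>.
\<close>

lemma open_weight_Suc_le:
  assumes th: "0 < \<theta>" "\<theta> < \<gamma>" "\<gamma> \<le> pi - 3 * \<theta>" and K: "0 \<le> K" and x: "x \<noteq> rt"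
    and low: "\<And>t. t \<le> (1 - 1 / b) * ratio \<theta> \<gamma> \<Longrightarrow> exp (K * weight (ln b) \<theta> (capped_step \<theta> \<gamma> t)) \<le> C"
  shows "open_weight K \<theta> \<gamma> (Suc j) x S \<le> of_bool (x \<in> S) *
    (C * (1 - (\<Prod>y\<in>ch x. of_bool (y \<in> S))) + (\<Prod>y\<in>ch x. open_weight K \<theta> \<gamma> j y S))"
proof (cases "ch x \<subseteq> S")
  case True
  have "card (ch x) = b" "\<gamma> < pi" using x th by (simp_all add: card_ch)
  then have "weight (ln b) \<theta> (capped_step \<theta> \<gamma> ((\<Sum>y\<in>ch x. ratio_at \<theta> \<gamma> j y S) / b))
      \<le> (\<Sum>y\<in>ch x. weight (ln b) \<theta> (ratio_at \<theta> \<gamma> j y S))"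
    by (intro weight_capped_step_le_sum th finite_ch b_ge ratio_at_bounds(2))
  then have "exp (K * weight (ln b) \<theta> (capped_step \<theta> \<gamma> ((\<Sum>y\<in>ch x. ratio_at \<theta> \<gamma> j y S) / b)))
      \<le> exp (\<Sum>y\<in>ch x. K * weight (ln b) \<theta> (ratio_at \<theta> \<gamma> j y S))"
    using K by (simp add: mult_left_mono sum_distrib_left[symmetric])
  also have "\<dots> = (\<Prod>y\<in>ch x. open_weight K \<theta> \<gamma> j y S)"
    using True finite_ch[of x] by (subst exp_sum) (auto simp: open_weight_def intro!: prod.cong)
  finally have le: "exp (K * weight (ln b) \<theta> (capped_step \<theta> \<gamma> ((\<Sum>y\<in>ch x. ratio_at \<theta> \<gamma> j y S) / b)))
      \<le> (\<Prod>y\<in>ch x. open_weight K \<theta> \<gamma> j y S)" .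
  have "(\<Prod>y\<in>ch x. of_bool (y \<in> S)) = (1 :: real)" using True by (intro prod.neutral) auto
  then show ?thesis using le by (simp add: open_weight_def[of K \<theta> \<gamma> "Suc j" x])
next
  case False
  then obtain z where z: "z \<in> ch x" "z \<notin> S" by blast
  have "(\<Sum>y\<in>ch x. ratio_at \<theta> \<gamma> j y S) = (\<Sum>y\<in>ch x - {z}. ratio_at \<theta> \<gamma> j y S)"
    using z finite_ch[of x] by (cases j) (auto simp: sum.remove[of _ z])
  also have "\<dots> \<le> real (card (ch x - {z})) * ratio \<theta> \<gamma>"
    using sum_bounded_above[of "ch x - {z}" "\<lambda>y. ratio_at \<theta> \<gamma> j y S" "ratio \<theta> \<gamma>"]
      ratio_at_bounds(2)[of \<theta> \<gamma>] th by auto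
  also have "real (card (ch x - {z})) = real b - 1"
    using z x card_ch[of x] b_ge by simp
  finally have "(\<Sum>y\<in>ch x. ratio_at \<theta> \<gamma> j y S) / b \<le> (real b - 1) * ratio \<theta> \<gamma> / b"
    by (rule divide_right_mono) simp
  also have "\<dots> = (1 - 1 / b) * ratio \<theta> \<gamma>" using b_ge by (simp add: field_simps)
  finally have "exp (K * weight (ln b) \<theta> (capped_step \<theta> \<gamma> ((\<Sum>y\<in>ch x. ratio_at \<theta> \<gamma> j y S) / b))) \<le> C"
    by (rule low)
  moreover have "(\<Prod>y\<in>ch x. of_bool (y \<in> S)) = (0 :: real)"
    using z finite_ch by (intro prod_zero) auto
  moreover have "0 \<le> (\<Prod>y\<in>ch x. open_weight K \<theta> \<gamma> j y S)"
    by (intro prod_nonneg) (auto simp: open_weight_nonneg)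
  ultimately show ?thesis by (simp add: open_weight_def[of K \<theta> \<gamma> "Suc j" x])
qed

text \<open>
  Let \<open>m\<close> be the bound for the mean at the children and \<open>p = 2 powr (- b)\<close> the probability that all
  children are open. The next mean is at most \<open>(C * (1 - p) + m ^ b) / 2\<close>, and for \<open>C = 1 / (1 - p)\<close> the
  value \<open>m = 1\<close> is preserved. Separating the event that all children are open is essential: the plain
  branching recursion for exponential moments explodes, since \<open>b \<ge> 2\<close> children that are open with
  probability \<open>1/2\<close> are not subcritical.
\<close>

lemma mean_open_weight_le_1:
  assumes th: "0 < \<theta>" "\<theta> < \<gamma>" "\<gamma> \<le> pi - 3 * \<theta>" and K: "0 \<le> K" and B: "finite B"
    and low: "\<And>t. t \<le> (1 - 1 / b) * ratio \<theta> \<gamma> \<Longrightarrow>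
      exp (K * weight (ln b) \<theta> (capped_step \<theta> \<gamma> t)) \<le> 1 / (1 - (1 / 2) ^ b)"
    and x: "x \<noteq> rt"
  shows "subset_mean B (open_weight K \<theta> \<gamma> j x) \<le> 1"
  using x
proof (induction j arbitrary: x)
  have "(1 / 2 :: real) ^ b \<le> (1 / 2) ^ 2" using b_ge by (intro power_decreasing) auto
  then have q: "(1 / 2 :: real) ^ b \<le> 1 / 4" by (simp add: power2_eq_square)
  define C where "C = 1 / (1 - (1 / 2 :: real) ^ b)"
  have "C \<le> 2" "0 \<le> C" "C * (1 - (1 / 2) ^ b) = 1" using q by (auto simp: C_def field_simps)
  note C = this
  have half: "subset_mean B (\<lambda>S. of_bool (x \<in> S)) \<le> 1 / 2" for x
  proof (cases "x \<in> B")
    case False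
    then have "subset_mean B (\<lambda>S. of_bool (x \<in> S)) = subset_mean B (\<lambda>S. 0)"
      by (intro subset_mean_cong) auto
    then show ?thesis using B by (simp add: subset_mean_const)
  qed (simp add: subset_mean_mem[OF B])
  {
    case 0
    have r0: "0 \<le> (1 - 1 / real b) * ratio \<theta> \<gamma>"
      using b_ge ratio_at_bounds[of \<theta> \<gamma> 0 x "{}"] th by simp
    have "weight (ln b) \<theta> 0 \<le> weight (ln b) \<theta> (capped_step \<theta> \<gamma> 0)"
      using th b_ge capped_step_props(3)[of \<theta> \<gamma> 0] by (intro weight_mono) auto
    then have "exp (K * weight (ln b) \<theta> 0) \<le> exp (K * weight (ln b) \<theta> (capped_step \<theta> \<gamma> 0))"
      using K by (simp add: mult_left_mono)
    also have "\<dots> \<le> C" unfolding C_def by (rule low[OF r0])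
    finally have e: "exp (K * weight (ln b) \<theta> 0) \<le> 2" using C by linarith
    have "subset_mean B (open_weight K \<theta> \<gamma> 0 x)
        = exp (K * weight (ln b) \<theta> 0) * subset_mean B (\<lambda>S. of_bool (x \<in> S))"
      by (subst subset_mean_cmult[symmetric]) (auto simp: open_weight_def intro!: subset_mean_cong)
    also have "\<dots> \<le> 2 * (1 / 2)"
      using half[of x] e subset_mean_mono[of B "\<lambda>_. 0" "\<lambda>S. of_bool (x \<in> S)"] B
      by (intro mult_mono) (auto simp: subset_mean_const)
    finally show ?case by simp
  next
    case (Suc j)
    let ?all = "\<lambda>S. \<Prod>y\<in>ch x. of_bool (y \<in> S) :: real"
    let ?prod = "\<lambda>S. \<Prod>y\<in>ch x. open_weight K \<theta> \<gamma> j y S"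
    have ch: "y \<noteq> rt" if "y \<in> ch x" for y using that by (simp add: ch_def)
    have prod: "subset_mean B ?prod = (\<Prod>y\<in>ch x. subset_mean B (open_weight K \<theta> \<gamma> j y))"
      "depends_on ?prod (\<Union>y\<in>ch x. cone j y)"
      using subset_mean_prod_indep[OF B finite_ch cone_disjoint open_weight_depends] by auto
    have "depends_on ?all (\<Union>y\<in>ch x. cone j y)"
      unfolding depends_on_def
    proof (intro allI prod.cong refl)
      fix S y assume "y \<in> ch x"
      then show "of_bool (y \<in> S) = (of_bool (y \<in> S \<inter> (\<Union>y\<in>ch x. cone j y)) :: real)"
        using in_cone_self[of y j] by auto
    qed
    from depends_on_comp2[OF this prod(2), of "\<lambda>u v. C * (1 - u) + v"]
    have dep: "depends_on (\<lambda>S. C * (1 - ?all S) + ?prod S) (\<Union>y\<in>ch x. cone j y)" .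
    have all_nonneg: "0 \<le> subset_mean B ?all"
      using subset_mean_mono[of B "\<lambda>_. 0" ?all] B by (simp add: subset_mean_const prod_nonneg)
    have "subset_mean B ?all \<le> subset_mean B (\<lambda>_. 1)"
      by (intro subset_mean_mono prod_le_1) auto
    then have all_le: "subset_mean B ?all \<le> 1" using B by (simp add: subset_mean_const)
    have two: "C * (1 - subset_mean B ?all) + subset_mean B ?prod \<le> 2"
    proof (cases "ch x \<subseteq> B")
      case True
      have "subset_mean B ?all = subset_mean B (\<lambda>S. of_bool (ch x \<subseteq> S))"
      proof (rule subset_mean_cong)
        fix S
        show "?all S = of_bool (ch x \<subseteq> S)"
        proof (cases "ch x \<subseteq> S")
          case True
          then show ?thesis by (subst prod.neutral) auto
        next
          case False
          then show ?thesis using finite_ch[of x] by (subst prod_zero) auto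
        qed
      qed
      also have "\<dots> = (1 / 2) ^ b"
        using subset_mean_superset[OF B True] card_ch[of x] Suc.prems by simp
      finally have "C * (1 - subset_mean B ?all) = 1" using C by simp
      moreover have "subset_mean B ?prod \<le> 1"
        unfolding prod
      proof (intro prod_le_1 conjI)
        fix y assume "y \<in> ch x"
        then show "subset_mean B (open_weight K \<theta> \<gamma> j y) \<le> 1" using Suc.IH ch by blast
        show "0 \<le> subset_mean B (open_weight K \<theta> \<gamma> j y)"
          using subset_mean_mono[of B "\<lambda>_. 0" "open_weight K \<theta> \<gamma> j y"] B
          by (simp add: subset_mean_const open_weight_nonneg)
      qed
      ultimately show ?thesis by simp
    next
      case False
      then obtain z where z: "z \<in> ch x" "z \<notin> B" by blast
      have "subset_mean B ?prod = subset_mean B (\<lambda>_. 0)"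
        using z finite_ch[of x] by (intro subset_mean_cong prod_zero) (auto simp: open_weight_def)
      moreover have "C * (1 - subset_mean B ?all) \<le> C"
        using mult_left_mono[of "1 - subset_mean B ?all" 1 C] C all_nonneg by simp
      ultimately show ?thesis using B C by (simp add: subset_mean_const)
    qed
    have "subset_mean B (open_weight K \<theta> \<gamma> (Suc j) x)
        \<le> subset_mean B (\<lambda>S. of_bool (x \<in> S) * (C * (1 - ?all S) + ?prod S))"
      by (intro subset_mean_mono open_weight_Suc_le th K Suc.prems) (use low in \<open>auto simp: C_def\<close>)
    also have "\<dots> = subset_mean B (\<lambda>S. of_bool (x \<in> S)) * subset_mean B (\<lambda>S. C * (1 - ?all S) + ?prod S)"
      by (rule subset_mean_indep[OF B _ _ dep, of "{x}"])
         (use parent_notin_cone in \<open>auto simp: depends_on_def\<close>)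
    also have "subset_mean B (\<lambda>S. C * (1 - ?all S) + ?prod S)
        = C * (1 - subset_mean B ?all) + subset_mean B ?prod"
      using B by (simp add: subset_mean_add subset_mean_cmult subset_mean_diff subset_mean_const)
    also have "subset_mean B (\<lambda>S. of_bool (x \<in> S)) * (C * (1 - subset_mean B ?all) + subset_mean B ?prod)
        \<le> (1 / 2) * 2"
    proof (rule mult_mono[OF half two])
      have "0 \<le> C * (1 - subset_mean B ?all)"
        using C all_le by (intro mult_nonneg_nonneg) auto
      moreover have "0 \<le> subset_mean B ?prod"
        using subset_mean_mono[of B "\<lambda>_. 0" ?prod] B
        by (simp add: subset_mean_const prod_nonneg open_weight_nonneg)
      ultimately show "0 \<le> C * (1 - subset_mean B ?all) + subset_mean B ?prod" by simp
    qed simp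
    finally show ?case by simp
  }
qed

text \<open>
  If no vertex attains the cap, the products of the ratios along the path to the root form a supersolution
  at level \<open>rho * cos \<theta>\<close>. Away from the root this is the recursion itself; at the root, which has \<open>b + 1\<close>
  children, the assumption on the cap is used.
\<close>

lemma killed_return_le_of_uncapped:
  assumes th: "0 < \<theta>" "\<theta> < \<gamma>" "\<gamma> < pi" and cos: "0 \<le> cos \<theta>"
    and root: "Suc b * ratio \<theta> \<gamma> \<le> 2 * b * cos \<theta>"
    and S: "S \<subseteq> root_ball N"
    and unc: "\<And>x. x \<in> root_ball N \<Longrightarrow> x \<noteq> rt \<Longrightarrow> ratio_at \<theta> \<gamma> (Suc N - dep x) x S < ratio \<theta> \<gamma>"
  shows "killed_return S n \<le> (rho (Suc b) * cos \<theta>) ^ n"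
proof -
  \<comment> \<open>The vertex \<open>x\<close> looks down to depth \<open>N + 1\<close>, where all vertices are closed, so that the values at a
    vertex and at its children are linked by the recursion.\<close>
  define V where "V = (\<lambda>x. ratio_at \<theta> \<gamma> (Suc N - dep x) x S)"
  define s where "s = sqrt (real b)"
  have s: "s > 0" "s * s = b" using b_ge by (auto simp: s_def)
  define g where "g = (\<lambda>x. \<Prod>i<dep x. V ((par ^^ i) x) / s)"
  have V0: "0 \<le> V x" "V x \<le> ratio \<theta> \<gamma>" for x using ratio_at_bounds[OF th] by (auto simp: V_def)
  have g0: "0 \<le> g x" for x unfolding g_def using V0 s by (intro prod_nonneg) auto
  have g_rt: "g rt = 1" by (simp add: g_def dep_rt)
  have g_step: "g y = V y / s * g (par y)" if "y \<noteq> rt" for y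
    unfolding g_def dep_par[OF that] prod.lessThan_Suc_shift by (simp add: funpow_swap1)
  have g_ch: "(\<Sum>y\<in>ch x. g y) = g x * (\<Sum>y\<in>ch x. V y) / s" for x
  proof -
    have "g y = g x * V y / s" if "y \<in> ch x" for y
      using that g_step[of y] by (simp add: ch_def mult_ac)
    then show ?thesis by (simp add: sum_distrib_left sum_divide_distrib)
  qed
  have nbrs: "(\<Sum>y\<in>{y. E x y}. g y) \<le> 2 * s * cos \<theta> * g x" if x: "x \<in> S" for x
  proof (cases "x = rt")
    case True
    have "(\<Sum>y\<in>ch rt. V y) \<le> Suc b * ratio \<theta> \<gamma>"
      using sum_bounded_above[of "ch rt" V "ratio \<theta> \<gamma>"] V0 card_ch[of rt] by simp
    also have "\<dots> \<le> 2 * (s * s) * cos \<theta>" using root s(2) by simp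
    also have "\<dots> = 2 * s * cos \<theta> * s" by simp
    finally show ?thesis using True s(1) by (simp add: nbrs_rt g_ch g_rt pos_divide_le_eq)
  next
    case False
    have xB: "dep x \<le> N" using x S by (auto simp: root_ball_def)
    have "V x = capped_step \<theta> \<gamma> ((\<Sum>y\<in>ch x. V y) / b)"
    proof -
      have "(\<Sum>y\<in>ch x. V y) = (\<Sum>y\<in>ch x. ratio_at \<theta> \<gamma> (N - dep x) y S)"
        by (intro sum.cong) (auto simp: V_def dep_ch)
      moreover have "Suc N - dep x = Suc (N - dep x)" using xB by simp
      ultimately show ?thesis using x by (simp add: V_def)
    qed
    moreover have "V x < ratio \<theta> \<gamma>" using unc[of x] xB False by (simp add: V_def root_ball_def)
    ultimately have st: "V x = 1 / (2 * cos \<theta> - (\<Sum>y\<in>ch x. V y) / b)" "(\<Sum>y\<in>ch x. V y) / b < 2 * cos \<theta>"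
      using capped_step_props(4)[OF th] by metis+
    then have "V x * (2 * cos \<theta> - (\<Sum>y\<in>ch x. V y) / b) = 1" by simp
    then have "g (par x) = g (par x) * (V x * (2 * cos \<theta> - (\<Sum>y\<in>ch x. V y) / b))" by simp
    also have "\<dots> = s * g x * (2 * cos \<theta> - (\<Sum>y\<in>ch x. V y) / b)"
      using g_step[OF False] s(1) by simp
    finally have "g (par x) + g x * (\<Sum>y\<in>ch x. V y) / s =
        2 * s * cos \<theta> * g x + (g x * (\<Sum>y\<in>ch x. V y) / s - s * g x * (\<Sum>y\<in>ch x. V y) / b)"
      by (simp add: algebra_simps)
    also have "s * g x * (\<Sum>y\<in>ch x. V y) / b = g x * (\<Sum>y\<in>ch x. V y) / s"
      unfolding s(2)[symmetric] using s(1) by simp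
    finally show ?thesis
      using False finite_ch par_notin_ch[OF False] by (simp add: nbrs_insert g_ch)
  qed
  have sup: "killed S g x \<le> rho (Suc b) * cos \<theta> * g x" if "x \<in> S" for x
  proof -
    have "(\<Sum>y\<in>{y. E x y} \<inter> S. g y) \<le> (\<Sum>y\<in>{y. E x y}. g y)"
      using finite_nbrs g0 by (intro sum_mono2) auto
    also have "\<dots> \<le> 2 * s * cos \<theta> * g x" by (rule nbrs[OF that])
    finally have "(\<Sum>y\<in>{y. E x y} \<inter> S. g y) / Suc b \<le> 2 * s * cos \<theta> * g x / Suc b"
      by (rule divide_right_mono) simp
    then show ?thesis using that by (simp add: killed_def rho_def s_def)
  qed
  show ?thesis
    by (rule killed_return_le_power[OF g0 g_rt _ sup]) (use cos in \<open>auto simp: rho_def\<close>)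
qed

end

section \<open>The upper bound for the return probability\<close>

context rooted_tree begin

text \<open>
  A union bound over the vertices at which the cap is attained; on that event the trivial bound \<open>rho ^ n\<close>
  suffices. The cap angle is \<open>pi - 2 * b * \<theta>\<close>: far enough from \<open>pi\<close> for convexity and for the condition
  at the root, and close enough that the weight at the cap is still of order \<open>b powr (pi/\<theta>)\<close>.
  In the exponent \<open>6 * b + 1\<close>, the part \<open>4 * b + 1\<close> comes from \<open>K\<close> and \<open>2 * b\<close> from the cap angle.
\<close>

lemma return_prob_sws_le:
  fixes \<theta> :: real
  assumes th: "0 < \<theta>" "4 * b * \<theta> < pi / 2" "1 - 1 / (8 * b) \<le> cos \<theta>"
  shows "return_prob (sws_step E) n (rt, 0) \<le> rho (Suc b) ^ n *
    (cos \<theta> ^ n + card (root_ball n) * exp (- ((1 / 2) ^ b * exp (- (6 * b + 1) * ln b) * exp (ln b * pi / \<theta>))))"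
proof -
  define \<gamma> where "\<gamma> = pi - 2 * b * \<theta>"
  \<comment> \<open>With a closed child the weight is at most \<open>b powr (4 * b + 1)\<close>, so \<open>K\<close> times it is at most \<open>2 powr (- b)\<close>.\<close>
  define K where "K = (1 / 2) ^ b * exp (- ((4 * real b + 1) * ln b))"
  let ?L = "ln (real b)"
  have b2: "real b \<ge> 2" using b_ge by simp
  have "2 * \<theta> \<le> b * \<theta>" "8 * (b * \<theta>) < pi" "\<gamma> = pi - 2 * (b * \<theta>)"
    using b2 th(1,2) by (simp_all add: \<gamma>_def)
  then have \<theta>: "\<theta> < \<gamma>" "\<gamma> \<le> pi - 3 * \<theta>" "\<gamma> < pi" "\<theta> < pi"
    and small: "2 * b * \<theta> < pi / 2"
    using th(1) by linarith+
  have K: "0 \<le> K" by (simp add: K_def)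
  have cap: "ratio \<theta> \<gamma> \<le> 1 + 1 / (2 * b)"
    unfolding \<gamma>_def using ratio_cap_le[of \<theta> "2 * b"] th(1) small b2 by simp
  have low: "exp (K * weight ?L \<theta> (capped_step \<theta> \<gamma> t)) \<le> 1 / (1 - (1 / 2) ^ b)"
    if t: "t \<le> (1 - 1 / b) * ratio \<theta> \<gamma>" for t
  proof -
    have "t \<le> (1 - 1 / b) * (1 + 1 / (2 * b))"
      by (rule order.trans[OF t mult_left_mono[OF cap]]) (use b2 in simp)
    also have "\<dots> \<le> 1 - 1 / (2 * b)" using b2 by (simp add: field_simps)
    also have "\<dots> \<le> 1 - 1 / (8 * b) - 1 / (4 * b)" using b2 by (simp add: field_simps)
    also have "\<dots> \<le> cos \<theta> - 1 / (4 * b)" using th(3) by simp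
    finally have "angle \<theta> t \<le> 4 * b * \<theta>" using angle_le_of_le[of \<theta> "4 * b" t] th \<theta> b2 by simp
    then have "angle \<theta> (capped_step \<theta> \<gamma> t) \<le> (4 * b + 1) * \<theta>"
      using capped_step_props(1)[OF th(1) \<theta>(1,3), of t] by (simp add: algebra_simps)
    then have "?L * angle \<theta> (capped_step \<theta> \<gamma> t) / \<theta> \<le> ?L * ((4 * b + 1) * \<theta>) / \<theta>"
      using th(1) b2 by (intro divide_right_mono mult_left_mono) auto
    then have "weight ?L \<theta> (capped_step \<theta> \<gamma> t) \<le> exp ((4 * b + 1) * ?L)"
      using th(1) by (simp add: weight_def mult_ac)
    then have "K * weight ?L \<theta> (capped_step \<theta> \<gamma> t) \<le> K * exp ((4 * b + 1) * ?L)"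
      using K by (rule mult_left_mono)
    also have "\<dots> = (1 / 2) ^ b * exp (- ((4 * b + 1) * ?L) + (4 * b + 1) * ?L)"
      unfolding exp_add by (simp add: K_def add.commute)
    also have "\<dots> = (1 / 2) ^ b" by simp
    finally have le: "K * weight ?L \<theta> (capped_step \<theta> \<gamma> t) \<le> (1 / 2) ^ b" .
    have q: "(1 / 2 :: real) ^ b < 1" using b_ge by (intro power_Suc_less_one power_less_one_iff[THEN iffD2]) auto
    have "1 - (1 / 2) ^ b \<le> exp (- ((1 / 2 :: real) ^ b))" using exp_ge_add_one_self[of "- ((1 / 2 :: real) ^ b)"] by simp
    then have "exp ((1 / 2 :: real) ^ b) \<le> 1 / (1 - (1 / 2) ^ b)"
      using q by (simp add: exp_minus field_simps)
    moreover have "exp (K * weight ?L \<theta> (capped_step \<theta> \<gamma> t)) \<le> exp ((1 / 2) ^ b)" using le by simp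
    ultimately show ?thesis by linarith
  qed
  have root: "Suc b * ratio \<theta> \<gamma> \<le> 2 * b * cos \<theta>"
  proof -
    have "Suc b * ratio \<theta> \<gamma> \<le> Suc b * (1 + 1 / (2 * b))" using cap by (intro mult_left_mono) auto
    also have "\<dots> = b + 3 / 2 + 1 / (2 * b)" using b2 by (simp add: field_simps)
    also have "\<dots> \<le> b + 3 / 2 + 1 / 4" using b2 by (simp add: field_simps)
    also have "\<dots> \<le> 2 * b - 1 / 4" using b2 by simp
    also have "\<dots> = 2 * b * (1 - 1 / (8 * b))" using b2 by (simp add: field_simps)
    also have "\<dots> \<le> 2 * b * cos \<theta>" using th(3) by (intro mult_left_mono) auto
    finally show ?thesis .
  qed
  have "1 / (8 * real b) \<le> 1" using b2 by (simp add: field_simps)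
  then have cos: "0 \<le> cos \<theta>" using th(3) by linarith
  let ?B = "root_ball n" and ?\<rho> = "rho (Suc b)"
  have B: "finite ?B" using card_root_ball by simp
  have \<rho>: "0 \<le> ?\<rho>" by (simp add: rho_def)
  \<comment> \<open>\<open>M\<close> times the open weight equals \<open>1\<close> at an open vertex whose ratio attains the cap.\<close>
  define M where "M = exp (- K * weight ?L \<theta> (ratio \<theta> \<gamma>))"
  let ?w = "\<lambda>x S. open_weight K \<theta> \<gamma> (Suc n - dep x) x S"
  have point: "killed_return S n \<le> ?\<rho> ^ n * (cos \<theta> ^ n + M * (\<Sum>x\<in>?B - {rt}. ?w x S))"
    if S: "S \<subseteq> ?B" for S
  proof (cases "\<forall>x\<in>?B - {rt}. ratio_at \<theta> \<gamma> (Suc n - dep x) x S < ratio \<theta> \<gamma>")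
    case True
    have "killed_return S n \<le> (?\<rho> * cos \<theta>) ^ n"
      by (rule killed_return_le_of_uncapped[OF th(1) \<theta>(1,3) cos root S]) (use True in auto)
    also have "\<dots> = ?\<rho> ^ n * (cos \<theta> ^ n + 0)" by (simp add: power_mult_distrib)
    also have "\<dots> \<le> ?\<rho> ^ n * (cos \<theta> ^ n + M * (\<Sum>x\<in>?B - {rt}. ?w x S))"
      using \<rho> by (intro mult_left_mono add_left_mono mult_nonneg_nonneg sum_nonneg open_weight_nonneg)
        (auto simp: M_def)
    finally show ?thesis .
  next
    case False
    then obtain x where x: "x \<in> ?B - {rt}" "ratio_at \<theta> \<gamma> (Suc n - dep x) x S = ratio \<theta> \<gamma>"
      using ratio_at_bounds(2)[OF th(1) \<theta>(1,3)] by (meson linorder_not_less order_antisym)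
    have "0 < ratio \<theta> \<gamma>"
      unfolding ratio_def using th(1) \<theta> by (intro divide_pos_pos sin_gt_zero) auto
    then have "x \<in> S" using x by (cases "Suc n - dep x") (auto split: if_splits)
    then have "1 = M * ?w x S" using x by (simp add: M_def open_weight_def flip: exp_add)
    also have "\<dots> \<le> M * (\<Sum>x\<in>?B - {rt}. ?w x S)"
      using x B by (intro mult_left_mono member_le_sum) (auto simp: M_def open_weight_nonneg)
    finally have "1 \<le> cos \<theta> ^ n + M * (\<Sum>x\<in>?B - {rt}. ?w x S)" using cos by (simp add: add_increasing)
    then have "?\<rho> ^ n \<le> ?\<rho> ^ n * (cos \<theta> ^ n + M * (\<Sum>x\<in>?B - {rt}. ?w x S))"
      using \<rho> mult_left_mono[of 1 _ "?\<rho> ^ n"] by simp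
    moreover have "killed_return S n \<le> ?\<rho> ^ n"
      using killed_return_mono[of S UNIV n] killed_return_UNIV_le[of n] by simp
    ultimately show ?thesis by linarith
  qed
  have "return_prob (sws_step E) n (rt, 0) = subset_mean ?B (\<lambda>S. killed_return S n)"
    by (rule return_prob_sws) simp
  also have "\<dots> \<le> subset_mean ?B (\<lambda>S. ?\<rho> ^ n * (cos \<theta> ^ n + M * (\<Sum>x\<in>?B - {rt}. ?w x S)))"
    by (rule subset_mean_mono[OF point])
  also have "\<dots> = ?\<rho> ^ n * (cos \<theta> ^ n + M * (\<Sum>x\<in>?B - {rt}. subset_mean ?B (?w x)))"
    using B by (simp add: subset_mean_cmult subset_mean_add subset_mean_sum subset_mean_const)
  also have "\<dots> \<le> ?\<rho> ^ n * (cos \<theta> ^ n + M * (\<Sum>x\<in>?B - {rt}. 1))"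
    using \<rho> mean_open_weight_le_1[OF th(1) \<theta>(1,2) K B low]
    by (intro mult_left_mono add_left_mono sum_mono) (auto simp: M_def)
  also have "\<dots> \<le> ?\<rho> ^ n * (cos \<theta> ^ n + M * card ?B)"
    using \<rho> B card_mono[of ?B "?B - {rt}"] by (intro mult_left_mono add_left_mono) (auto simp: M_def)
  also have "M = exp (- ((1 / 2) ^ b * exp (- (6 * b + 1) * ln b) * exp (ln b * pi / \<theta>)))"
  proof -
    have "?L * \<gamma> / \<theta> = ?L * pi / \<theta> - 2 * b * ?L"
      using th(1) by (simp add: \<gamma>_def field_simps)
    then have "weight ?L \<theta> (ratio \<theta> \<gamma>) = exp (?L * pi / \<theta> - 2 * b * ?L)"
      using angle_ratio[OF th(1) \<theta>(4), of \<gamma>] \<theta> th(1) by (simp add: weight_def)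
    then have "K * weight ?L \<theta> (ratio \<theta> \<gamma>) =
        (1 / 2) ^ b * (exp (- ((4 * real b + 1) * ?L)) * exp (?L * pi / \<theta> - 2 * b * ?L))"
      by (simp add: K_def)
    also have "\<dots> = (1 / 2) ^ b * (exp (- (6 * real b + 1) * ?L) * exp (?L * pi / \<theta>))"
      by (simp add: exp_add[symmetric] algebra_simps)
    finally show ?thesis by (simp add: M_def mult.assoc)
  qed
  finally show ?thesis by (simp add: mult.commute)
qed

end

section \<open>Asymptotics\<close>

text \<open>
  The exponent of the lower bound when the ball has radius about \<open>x n\<close>, where \<open>b powr (x n) = n / (ln n)^4\<close>.
\<close>

lemma confinement_exponent_limit:
  fixes L y :: real
  assumes "L > 0" "y > 0"
  defines "x \<equiv> \<lambda>n :: nat. (ln n - 4 * ln (ln n)) / L"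
  shows "(\<lambda>n. (2 * (y * (n / ln n ^ 4)) * ln 2 - 2 * n * ln (cos (pi / (x n + 1)))
      - 2 * ln (sin (pi / (x n + 2))) + ln (2 * (y * (n / ln n ^ 4)))) * ((ln n)\<^sup>2 / n)) \<longlonglongrightarrow> (pi * L) * (pi * L)"
  unfolding x_def using assms(1,2) by real_asymp

text \<open>
  The exponent of the upper bound for the \<open>\<theta>\<close> with \<open>b powr (pi/\<theta>) = n * ln n\<close>.
\<close>

lemma supersolution_exponent_limit:
  fixes L :: real
  assumes "L > 0"
  shows "(\<lambda>n :: nat. (- ln 2 - 2 * n * ln (cos (pi * L / (ln n + ln (ln n))))) * ((ln n)\<^sup>2 / n)) \<longlonglongrightarrow> (pi * L) * (pi * L)"
  using assms by real_asymp

lemma bad_event_negligible: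
  fixes L y C :: real
  assumes "L > 0" "y > 0" "C > 0"
  shows "\<forall>\<^sub>F n :: nat in sequentially. 2 * y * exp (2 * n * L) * exp (- (C * (n * ln n)))
    \<le> exp (2 * n * ln (cos (pi * L / (ln n + ln (ln n)))))"
  using assms by real_asymp

lemma lim_cap_angle: "L > 0 \<Longrightarrow> (\<lambda>n :: nat. pi * L / (ln n + ln (ln n))) \<longlonglongrightarrow> 0"
  by real_asymp

context rooted_tree begin

lemma rho_pos: "rho (Suc b) > 0"
  using b_ge by (simp add: rho_def)

lemma ln_b_pos: "ln (real b) > 0"
  using b_ge by simp

lemma card_root_ball_pos: "0 < card (root_ball r)"
  using card_root_ball[of r] card_gt_0_iff[of "root_ball r"] by (auto simp: root_ball_def dep_rt intro: exI[of _ rt])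

text \<open>
  Keep only the sets \<open>S\<close> that contain the ball of radius \<open>r\<close>.
\<close>

lemma return_prob_sws_ge:
  "(1 / 2) ^ card (root_ball r) * ((rho (Suc b) * cos (pi / (real r + 2))) ^ (2 * m) *
      (sin (pi / (real r + 2)))\<^sup>2 / card (root_ball r)) \<le> return_prob (sws_step E) (2 * m) (rt, 0)"
proof -
  define N where "N = max (2 * m) r"
  have B: "finite (root_ball N)" "root_ball r \<subseteq> root_ball N" using card_root_ball by (auto simp: root_ball_def N_def)
  have "(1 / 2) ^ card (root_ball r) * killed_return (root_ball r) (2 * m)
      = subset_mean (root_ball N) (\<lambda>S. killed_return (root_ball r) (2 * m) * of_bool (root_ball r \<subseteq> S))"
    unfolding subset_mean_cmult subset_mean_superset[OF B] by (rule mult.commute)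
  also have "\<dots> \<le> subset_mean (root_ball N) (\<lambda>S. killed_return S (2 * m))"
    using killed_return_mono killed_return_nonneg by (intro subset_mean_mono) auto
  also have "\<dots> = return_prob (sws_step E) (2 * m) (rt, 0)"
    by (rule return_prob_sws[symmetric]) (simp add: N_def)
  finally show ?thesis
    using mult_left_mono[OF killed_return_root_ball_ge[of r m], of "(1 / 2) ^ card (root_ball r)"] by simp
qed

text \<open>
  The previous bound for the radius \<open>r\<close> obtained by rounding \<open>x\<close> down, with every term made monotone in \<open>x\<close>.
\<close>

lemma ln_return_prob_ge:
  fixes n :: nat and x :: real
  assumes "1 < x"
  defines "M \<equiv> 2 * (b * exp (ln b * x))"
  defines "X \<equiv> return_prob (sws_step E) (2 * n) (rt, 0) / rho (Suc b) ^ (2 * n)"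
  shows "0 < X" "- ln X \<le> M * ln 2 - 2 * n * ln (cos (pi / (x + 1))) - 2 * ln (sin (pi / (x + 2))) + ln M"
proof -
  define r where "r = nat \<lfloor>x\<rfloor>"
  have r: "real r \<le> x" "x \<le> real r + 1" "1 \<le> r" using assms(1) by (auto simp: r_def le_nat_iff le_floor_iff)
  define k where "k = real (card (root_ball r))"
  let ?t = "pi / (real r + 2)"
  have "k \<le> 2 * (b * real b ^ r)"
    using card_root_ball[of r] unfolding k_def by (metis of_nat_le_iff of_nat_mult of_nat_numeral of_nat_power power_Suc)
  also have "real b ^ r = exp (ln b * real r)" using b_ge by (simp add: exp_of_nat2_mult)
  also have "2 * (b * exp (ln b * real r)) \<le> M"
    unfolding M_def using r ln_b_pos by (intro mult_left_mono) auto
  finally have kM: "k \<le> M" .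
  have k1: "1 \<le> k" using card_root_ball_pos[of r] by (simp add: k_def)
  have p: "0 < pi / (x + 2)" "pi / (x + 2) \<le> ?t" "?t \<le> pi / (x + 1)" "pi / (x + 1) < pi / 2" "?t < pi / 2"
    using r assms(1) by (auto intro!: divide_left_mono simp: pos_divide_less_eq)
  have s: "0 < sin (pi / (x + 2))" "sin (pi / (x + 2)) \<le> sin ?t"
    by (rule sin_gt_zero sin_monotone_2pi_le; use p pi_gt_zero in linarith)+
  have c: "cos (pi / (x + 1)) \<le> cos ?t" "0 < cos ?t"
    by (rule cos_monotone_0_pi_le cos_gt_zero; use p pi_gt_zero in linarith)+
  have \<rho>: "0 < rho (Suc b) ^ (2 * n)" using rho_pos by simp
  define Y where "Y = (1 / 2) ^ card (root_ball r) * (cos ?t ^ (2 * n) * (sin ?t)\<^sup>2 / k)"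
  have Y0: "0 < Y" unfolding Y_def using s c k1 by (intro mult_pos_pos divide_pos_pos zero_less_power) auto
  have "Y \<le> X"
    unfolding X_def pos_le_divide_eq[OF \<rho>] Y_def k_def
    using return_prob_sws_ge[of r n] by (simp add: power_mult_distrib mult_ac)
  then show "0 < X" using Y0 by simp
  have "- ln X \<le> - ln Y" using Y0 \<open>Y \<le> X\<close> by simp
  also have "- ln Y = k * ln 2 - 2 * n * ln (cos ?t) - 2 * ln (sin ?t) + ln k"
    unfolding Y_def using s c k1
    by (simp add: ln_mult ln_div ln_realpow k_def)
  finally have *: "- ln X \<le> k * ln 2 - 2 * n * ln (cos ?t) - 2 * ln (sin ?t) + ln k" .
  show "- ln X \<le> M * ln 2 - 2 * n * ln (cos (pi / (x + 1))) - 2 * ln (sin (pi / (x + 2))) + ln M"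
  proof -
    have "k * ln 2 \<le> M * ln 2" "ln k \<le> ln M" using kM k1 by auto
    moreover have "ln (sin (pi / (x + 2))) \<le> ln (sin ?t)" using s by simp
    moreover have "0 < cos (pi / (x + 1))" using p assms(1) by (intro cos_gt_zero) auto
    then have "ln (cos (pi / (x + 1))) \<le> ln (cos ?t)" using c by simp
    then have "2 * n * ln (cos (pi / (x + 1))) \<le> 2 * n * ln (cos ?t)" by (intro mult_left_mono) auto
    ultimately show ?thesis using * by linarith
  qed
qed

text \<open>
  Both bounds, taken to the same limit. In the upper bound \<open>b powr (pi/\<theta>) = n * ln n\<close> exceeds the exponent
  \<open>2 * n * ln b\<close> of the number of vertices in the union bound and changes \<open>1/\<theta>\<close> only by a factor \<open>1 + o(1)\<close>.
\<close>

lemma return_prob_sws_asymptotics: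
  defines "L \<equiv> ln (real b)"
  defines "X \<equiv> \<lambda>n. return_prob (sws_step E) (2 * n) (rt, 0) / rho (Suc b) ^ (2 * n)"
  shows "\<forall>\<^sub>F n in sequentially. 0 < X n"
    and "(\<lambda>n. - ln (X n) * ((ln n)\<^sup>2 / n)) \<longlonglongrightarrow> (pi * L) * (pi * L)"
proof -
  have L: "L > 0" using ln_b_pos by (simp add: L_def)
  have b: "real b > 0" using b_ge by simp
  define x where "x = (\<lambda>n :: nat. (ln n - 4 * ln (ln n)) / L)"
  define U where "U = (\<lambda>n :: nat. 2 * (b * (n / ln n ^ 4)) * ln 2 - 2 * n * ln (cos (pi / (x n + 1)))
      - 2 * ln (sin (pi / (x n + 2))) + ln (2 * (b * (n / ln n ^ 4))))"
  define \<theta> where "\<theta> = (\<lambda>n :: nat. pi * L / (ln n + ln (ln n)))"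
  have ev_x: "\<forall>\<^sub>F n in sequentially. 1 < x n"
    unfolding x_def using L by real_asymp
  have ev_n: "\<forall>\<^sub>F n :: nat in sequentially. 3 \<le> n" by (rule eventually_ge_at_top)
  have ln_gt: "1 < ln (real n)" if "3 \<le> n" for n
  proof -
    have "exp 1 < real n" using that exp_le e_less_272 by linarith
    then show ?thesis by (metis exp_gt_zero ln_exp ln_less_cancel_iff order.strict_trans)
  qed
  have upper: "\<forall>\<^sub>F n in sequentially. 0 < X n \<and> - ln (X n) \<le> U n"
    using ev_x ev_n
  proof eventually_elim
    case (elim n)
    have "ln b * x n = ln n - 4 * ln (ln n)" using L by (simp add: x_def L_def)
    then have "exp (ln b * x n) = n / ln n ^ 4"
      using ln_gt[of n] elim exp_of_nat_mult[of 4 "ln (ln (real n))"] by (simp add: exp_diff)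
    then show ?case using ln_return_prob_ge[of "x n" n] elim by (simp add: X_def U_def)
  qed
  then show pos: "\<forall>\<^sub>F n in sequentially. 0 < X n" by (rule eventually_mono) simp
  have "\<theta> \<longlonglongrightarrow> 0" unfolding \<theta>_def by (rule lim_cap_angle[OF L])
  then have \<theta>_lim: "(\<lambda>n. 4 * b * \<theta> n) \<longlonglongrightarrow> 0" "(\<lambda>n. cos (\<theta> n)) \<longlonglongrightarrow> cos 0"
    by (intro tendsto_mult_right_zero tendsto_cos; assumption)+
  have ev_\<theta>: "\<forall>\<^sub>F n in sequentially. 4 * b * \<theta> n < pi / 2"
      "\<forall>\<^sub>F n in sequentially. 1 - 1 / (8 * b) < cos (\<theta> n)"
    using order_tendstoD(2)[OF \<theta>_lim(1), of "pi / 2"] order_tendstoD(1)[OF \<theta>_lim(2), of "1 - 1 / (8 * b)"] b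
    by auto
  define C where "C = (1 / 2) ^ b * exp (- (6 * b + 1) * ln b)"
  have C: "0 < C" by (simp add: C_def)
  have lower: "\<forall>\<^sub>F n in sequentially. - ln 2 - 2 * n * ln (cos (\<theta> n)) \<le> - ln (X n)"
    using ev_\<theta> ev_n pos bad_event_negligible[OF L b C]
  proof eventually_elim
    case (elim n)
    have ln1: "1 < ln (real n)" "0 < ln (ln (real n))" using ln_gt[of n] elim by auto
    have th: "0 < \<theta> n" unfolding \<theta>_def using ln1 L by (intro divide_pos_pos add_pos_pos) auto
    have "ln b * pi / \<theta> n = ln n + ln (ln n)" using L ln1 by (simp add: \<theta>_def L_def)
    then have e: "exp (ln b * pi / \<theta> n) = n * ln n" using ln1 elim by (simp add: exp_add)
    have "1 / (8 * real b) \<le> 1" using b_ge by (simp add: field_simps)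
    then have cos: "0 < cos (\<theta> n)" using elim by linarith
    have pow: "cos (\<theta> n) ^ (2 * n) = exp (2 * n * ln (cos (\<theta> n)))"
      using cos exp_of_nat_mult[of "2 * n" "ln (cos (\<theta> n))"] by simp
    have "real (card (root_ball (2 * n))) \<le> 2 * (b * real b ^ (2 * n))"
      using card_root_ball[of "2 * n"] by (metis of_nat_le_iff of_nat_mult of_nat_numeral of_nat_power power_Suc)
    also have "real b ^ (2 * n) = exp (2 * n * L)"
      using b exp_of_nat_mult[of "2 * n" L] by (simp add: L_def)
    finally have card: "real (card (root_ball (2 * n))) \<le> 2 * b * exp (2 * n * L)" by simp
    have bad: "2 * b * exp (2 * n * L) * exp (- (C * (n * ln n))) \<le> exp (2 * n * ln (cos (\<theta> n)))"
      unfolding \<theta>_def using elim(5) by simp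
    have le: "return_prob (sws_step E) (2 * n) (rt, 0) \<le> rho (Suc b) ^ (2 * n) *
        (cos (\<theta> n) ^ (2 * n) + card (root_ball (2 * n)) * exp (- (C * exp (ln b * pi / \<theta> n))))"
      unfolding C_def by (rule return_prob_sws_le[OF th]) (use elim in auto)
    have "X n \<le> cos (\<theta> n) ^ (2 * n) + card (root_ball (2 * n)) * exp (- (C * (n * ln n)))"
      using le rho_pos unfolding X_def e by (subst pos_divide_le_eq) (simp_all add: mult.commute)
    also have "\<dots> \<le> cos (\<theta> n) ^ (2 * n) + 2 * b * exp (2 * n * L) * exp (- (C * (n * ln n)))"
      using card by (intro add_left_mono mult_right_mono) auto
    also have "\<dots> \<le> 2 * exp (2 * n * ln (cos (\<theta> n)))"
      using bad unfolding pow by linarith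
    finally have "ln (X n) \<le> ln (2 * exp (2 * n * ln (cos (\<theta> n))))" using elim by simp
    then show ?case by (simp add: ln_mult)
  qed
  show "(\<lambda>n. - ln (X n) * ((ln n)\<^sup>2 / n)) \<longlonglongrightarrow> (pi * L) * (pi * L)"
  proof (rule tendsto_sandwich)
    show "(\<lambda>n. (- ln 2 - 2 * n * ln (cos (\<theta> n))) * ((ln n)\<^sup>2 / n)) \<longlonglongrightarrow> (pi * L) * (pi * L)"
      using supersolution_exponent_limit[OF L] by (simp add: \<theta>_def)
    show "(\<lambda>n. U n * ((ln n)\<^sup>2 / n)) \<longlonglongrightarrow> (pi * L) * (pi * L)"
      unfolding U_def x_def by (rule confinement_exponent_limit[OF L b])
    show "\<forall>\<^sub>F n in sequentially. (- ln 2 - 2 * n * ln (cos (\<theta> n))) * ((ln n)\<^sup>2 / n) \<le> - ln (X n) * ((ln n)\<^sup>2 / n)"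
      using lower by eventually_elim (intro mult_right_mono, auto)
    show "\<forall>\<^sub>F n in sequentially. - ln (X n) * ((ln n)\<^sup>2 / n) \<le> U n * ((ln n)\<^sup>2 / n)"
      using upper by eventually_elim (intro mult_right_mono, auto)
  qed
qed

text \<open>
  The killed walks on balls of growing radius exhaust the spectral radius from below.
\<close>

lemma spectral_radius_walk: "spectral_radius (walk_step E) rt = ereal (rho (Suc b))"
proof (rule antisym)
  have "root n (killed_return UNIV n) \<le> rho (Suc b)" if "n > 0" for n
    using real_root_le_mono[OF that killed_return_UNIV_le[of n]] rho_pos that
    by (simp add: real_root_power_cancel)
  then have "\<forall>\<^sub>F n in sequentially. ereal (root n (killed_return UNIV n)) \<le> ereal (rho (Suc b))"
    by (intro eventually_mono[OF eventually_gt_at_top[of 0]]) simp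
  then show "spectral_radius (walk_step E) rt \<le> ereal (rho (Suc b))"
    unfolding spectral_radius_def return_prob_walk by (rule Limsup_bounded)
next
  have ge: "ereal (rho (Suc b) * cos (pi / (real r + 2))) \<le> spectral_radius (walk_step E) rt" if "1 \<le> r" for r
  proof -
    let ?\<mu> = "rho (Suc b) * cos (pi / (real r + 2))"
    define c where "c = (sin (pi / (real r + 2)))\<^sup>2 / card (root_ball r)"
    have t: "0 < pi / (real r + 2)" "pi / (real r + 2) < pi / 2"
      using that by (auto simp: pos_divide_less_eq)
    have "0 < sin (pi / (real r + 2))" using t pi_gt_zero by (intro sin_gt_zero) linarith+
    then have c: "0 < c" unfolding c_def using card_root_ball_pos[of r] by (intro divide_pos_pos zero_less_power) auto
    have \<mu>: "0 < ?\<mu>" using t rho_pos by (intro mult_pos_pos cos_gt_zero) auto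
    have "(\<lambda>m. root (2 * m) c) \<longlonglongrightarrow> 1"
      using LIMSEQ_subseq_LIMSEQ[OF LIMSEQ_root_const[OF c], of "\<lambda>m. 2 * m"]
      by (simp add: strict_mono_def o_def)
    then have "(\<lambda>m. ?\<mu> * root (2 * m) c) \<longlonglongrightarrow> ?\<mu> * 1" by (intro tendsto_intros)
    then have "(\<lambda>m. ereal (?\<mu> * root (2 * m) c)) \<longlonglongrightarrow> ereal ?\<mu>" by simp
    then have "ereal ?\<mu> = limsup (\<lambda>m. ereal (?\<mu> * root (2 * m) c))"
      by (intro lim_imp_Limsup[symmetric]) auto
    also have "\<dots> \<le> limsup ((\<lambda>n. ereal (root n (killed_return UNIV n))) \<circ> (\<lambda>m. 2 * m))"
    proof (rule Limsup_mono, rule eventually_mono[OF eventually_gt_at_top[of 0]])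
      fix m :: nat assume m: "0 < m"
      have "?\<mu> ^ (2 * m) * c \<le> killed_return UNIV (2 * m)"
        using killed_return_root_ball_ge[of r m] killed_return_mono[of "root_ball r" UNIV "2 * m"]
        by (simp add: c_def)
      then have "root (2 * m) (?\<mu> ^ (2 * m) * c) \<le> root (2 * m) (killed_return UNIV (2 * m))"
        using m by (intro real_root_le_mono) auto
      then show "ereal (?\<mu> * root (2 * m) c) \<le> ((\<lambda>n. ereal (root n (killed_return UNIV n))) \<circ> (\<lambda>m. 2 * m)) m"
        using m \<mu> real_root_power_cancel[of "2 * m" ?\<mu>] by (simp add: real_root_mult)
    qed
    also have "\<dots> \<le> limsup (\<lambda>n. ereal (root n (killed_return UNIV n)))"
      by (rule limsup_subseq_mono) (simp add: strict_mono_def)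
    finally show ?thesis by (simp add: spectral_radius_def return_prob_walk)
  qed
  have "(\<lambda>r. rho (Suc b) * cos (pi / (real r + 2))) \<longlonglongrightarrow> rho (Suc b) * 1"
    by (intro tendsto_mult tendsto_const) real_asymp
  then have "(\<lambda>r. ereal (rho (Suc b) * cos (pi / (real r + 2)))) \<longlonglongrightarrow> ereal (rho (Suc b))" by simp
  then show "ereal (rho (Suc b)) \<le> spectral_radius (walk_step E) rt"
    by (rule LIMSEQ_le_const2) (use ge in auto)
qed

end

theorem theorem1:
  fixes d :: nat and E :: "'v \<Rightarrow> 'v \<Rightarrow> bool" and o\<^sub>T :: 'v
  assumes "d \<ge> 3" and "regular_tree d E"
  shows "spectral_radius (walk_step E) o\<^sub>T = ereal (rho d) \<and>
    (\<exists>\<epsilon> :: nat \<Rightarrow> real. \<epsilon> \<longlonglongrightarrow> 0 \<and>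
      (\<forall>\<^sub>F n in sequentially.
        return_prob (sws_step E) (2 * n) (o\<^sub>T, 0) =
          rho d ^ (2 * n) *
          exp (- (pi\<^sup>2 * (ln (real d - 1))\<^sup>2 + \<epsilon> n) * (real n / (ln (real n))\<^sup>2))))"
proof -
  obtain par dep where "rooted_tree E o\<^sub>T par dep (d - 1)"
    using regular_tree_rooted[OF assms] by blast
  then interpret rooted_tree E "o\<^sub>T" par dep "d - 1" .
  have d: "Suc (d - 1) = d" "real (d - 1) = real d - 1" using assms(1) by auto
  define L where "L = ln (real d - 1)"
  define X where "X = (\<lambda>n. return_prob (sws_step E) (2 * n) (o\<^sub>T, 0) / rho d ^ (2 * n))"
  \<comment> \<open>The error term is determined by the equation as soon as the return probability is positive.\<close>
  define \<epsilon> where "\<epsilon> = (\<lambda>n :: nat. - ln (X n) * ((ln n)\<^sup>2 / n) - (pi * L) * (pi * L))"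
  have lim: "(\<lambda>n. - ln (X n) * ((ln n)\<^sup>2 / n)) \<longlonglongrightarrow> (pi * L) * (pi * L)"
    and pos: "\<forall>\<^sub>F n in sequentially. 0 < X n"
    using return_prob_sws_asymptotics unfolding X_def L_def d by blast+
  have "\<epsilon> \<longlonglongrightarrow> (pi * L) * (pi * L) - (pi * L) * (pi * L)"
    unfolding \<epsilon>_def by (intro tendsto_diff lim tendsto_const)
  then have "\<epsilon> \<longlonglongrightarrow> 0" by simp
  moreover have "\<forall>\<^sub>F n in sequentially. return_prob (sws_step E) (2 * n) (o\<^sub>T, 0) =
      rho d ^ (2 * n) * exp (- (pi\<^sup>2 * L\<^sup>2 + \<epsilon> n) * (real n / (ln (real n))\<^sup>2))"
    using pos eventually_gt_at_top[of 1]
  proof eventually_elim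
    case (elim n)
    have "0 < ln (real n)" using elim by simp
    then have "- (pi\<^sup>2 * L\<^sup>2 + \<epsilon> n) * (real n / (ln (real n))\<^sup>2) = ln (X n)"
      using elim by (simp add: \<epsilon>_def power2_eq_square)
    then show ?case using elim(1) rho_pos[unfolded d] by (simp add: X_def)
  qed
  ultimately show ?thesis using spectral_radius_walk[unfolded d] by (auto simp: L_def)
qed

end
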